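(* Let $n\ge1$. Assume $|q|\neq1$, $b_6\neq0$, $b_5^2\neq q^{-1},1,q$, and that the denominators occurring below are nonzero. Then the entries of the deformation matrix $B_n^*$ are given by $$\mathfrak R_{n,+}=\frac{\hat\gamma_n}{b_6\gamma_n}\Bigg\{x+\frac1{1-b_5^2}\Bigg[-\frac{q\big(t^2b_6+g_n^2b_5^2b_6-tg_nb_5^2(1+b_6^2)\big)}{g_nb_6}+\frac{qt^2b_5\prod_{j=1}^4(1-b_jg_n)}{g_n(f_ng_n-1)(tg_n-b_5)}-\frac{q\prod_{j=1}^4(t-b_jb_5)}{(tg_n-b_5)(f_nb_5-t)}\Bigg]\Bigg\},$$ $$\mathfrak R_{n,-}=\frac{b_6\gamma_{n-1}}{\hat\gamma_{n-1}}\Bigg\{x+\frac1{1-b_5^2}\Bigg[\frac{q\big(t^2b_6+g_n^2b_5^2b_6-tg_n(1+b_6^2)\big)}{g_nb_6}-\frac{qt^2b_5\prod_{j=1}^4(1-b_jg_n)}{g_n(f_ng_n-1)(tg_n-b_5)}+\frac{q\prod_{j=1}^4(t-b_jb_5)}{(tg_n-b_5)(f_nb_5-t)}\Bigg]\Bigg\},$$ $$\mathfrak P_{n,+}=a_n\left[\frac{\hat\gamma_n}{b_6\gamma_n}-\frac{b_6\gamma_n}{\hat\gamma_n}\right],\qquad \mathfrak P_{n,-}=a_n\left[\frac{\hat\gamma_{n-1}}{b_6\gamma_{n-1}}-\frac{b_6\gamma_{n-1}}{\hat\gamma_{n-1}}\right].$$ Here $\hat\gamma_m=\gamma_m(qt)$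 and all other quantities are evaluated at $t$.
   Context: Fix $q$ with $0<|q|<1$, $(a;q)_\infty=\prod_{j\ge0}(1-aq^j)$, $(a_1,\dots,a_m;q)_\infty=\prod_i(a_i;q)_\infty$. Let $b_1,b_2,b_3,b_4,b_6$ be nonzero complex parameters with $b_1b_2b_3b_4=1$, and let $t\ne0$ be the deformation variable. Non-vanishing hypotheses are understood at every point of the lattice $tq^{\mathbb Z}$ that is involved. The weight is $$w(x;t)=\frac{(b_2x,b_3x,b_6^{-1}xt^{-1};q)_\infty}{(b_1x,b_4x,b_6xt^{-1};q)_\infty}.$$ Put $$D_+(x;t)=b_6(1-b_1x)(1-b_4x)(t-b_6x),\qquad D_-(x;t)=(1-b_2x)(1-b_3x)(b_6t-x),$$ $$E_+(x;t)=b_6^{-1}(b_6qt-x),\qquad E_-(x;t)=qt-b_6x,$$ so that $w(qx;t)/w(x;t)=D_+/D_-$ and $w(x;qt)/w(x;t)=E_+/E_-$. Orthogonality is with respect to a Thomae–Jackson $q$-integral $\int_G$ in $x$ whose terminals coincide with zeros/poles of the weight, so that boundary terms vanish. Concretely, the Stieltjes function $\phi(x;t)=\int_G \frac{w(y;t)}{x-y}$ satisfies $D_-(x;t)\phi(qx;t)=D_+(x;t)\phi(x;t)+(q-1)x\,U(x;t)$ and $E_-(x;t)\phi(x;qt)=E_+(x;t)\phi(x;t)+(q-1)t\,T(x;t)$ with $U,T$ polynomial in $x$. The orthonormal polynomials $p_n(x;t)=\gamma_nx^n+\cdots$ ($\int_G w\,p_np_m=\delta_{nm}$, $\gamma_n=\gamma_n(t)\ne0$)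 are assumed to exist for all $n\ge0$; $a_n=\gamma_{n-1}/\gamma_n$ for $n\ge1$ is the off-diagonal coefficient of the three-term recurrence. Functions of the second kind: $q_n(x;t)=\int_G \frac{w(y;t)p_n(y;t)}{x-y}=\gamma_n^{-1}x^{-n-1}(1+O(x^{-1}))$. For $n\ge1$ set $$Y_n(x;t)=\begin{pmatrix}p_n & q_n/w\\ p_{n-1}& q_{n-1}/w\end{pmatrix}.$$ The spectral matrix $A_n^*$ is the matrix, polynomial in $x$, defined by $D_+(x;t)\,Y_n(qx;t)=A_n^*(x;t)\,Y_n(x;t)$; write $$A_n^*=\begin{pmatrix}\mathfrak W_{n,+}&-\mathfrak T_{n,+}\\ \mathfrak T_{n,-}&\mathfrak W_{n,-}\end{pmatrix}.$$ The deformation matrix $B_n^*$ is the matrix, polynomial in $x$, defined (with the normalization used here) by $$-E_+(x;t)\,Y_n(x;qt)=B_n^*(x;t)\,Y_n(x;t),\qquad B_n^*=\begin{pmatrix}\mathfrak R_{n,+}&-\mathfrak P_{n,+}\\ \mathfrak P_{n,-}&\mathfrak R_{n,-}\end{pmatrix}.$$ Put $b_5=b_1b_4b_6q^n$. Then $\mathfrak T_{n,+}$ is $x$ times a polynomial of degree one in $x$, and $g_n=g_n(t)$ denotes the zero of that degree-one polynomial. The variable $f_n=f_n(t)$ is defined by $$\mathfrak W_{n,+}(g_n(t);t)=-\frac1t\,(g_n(t)-b_6t)(b_6g_n(t)-t)\,\big(f_n(q^{-1}t)\,g_n(t)-1\big),$$ where it is assumed that $g_n(t)\ne 0,\,b_6t,\,b_6^{-1}t$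 so that $f_n$ is well defined. *)

theory Defs
  imports "HOL-Analysis.Analysis" "HOL-Computational_Algebra.Polynomial"
begin

definition qpoch_inf :: "complex \<Rightarrow> complex \<Rightarrow> complex" where
  "qpoch_inf a q = (\<Prod>j. 1 - a * q ^ j)"

text \<open>The parameters are a family \<open>b\<close> of which only \<open>b 1, b 2, b 3, b 4, b 6\<close> are used.
  The deformation variable is always written \<open>t\<close> and precedes the spectral variable \<open>x\<close>.\<close>

definition weight_num :: "complex \<Rightarrow> (nat \<Rightarrow> complex) \<Rightarrow> complex \<Rightarrow> complex \<Rightarrow> complex" where
  "weight_num q b t x =
     qpoch_inf (b 2 * x) q * qpoch_inf (b 3 * x) q * qpoch_inf (x / (b 6 * t)) q"

definition weight_den :: "complex \<Rightarrow> (nat \<Rightarrow> complex) \<Rightarrow> complex \<Rightarrow> complex \<Rightarrow> complex" where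
  "weight_den q b t x =
     qpoch_inf (b 1 * x) q * qpoch_inf (b 4 * x) q * qpoch_inf (b 6 * x / t) q"

definition weight :: "complex \<Rightarrow> (nat \<Rightarrow> complex) \<Rightarrow> complex \<Rightarrow> complex \<Rightarrow> complex" where
  "weight q b t x = weight_num q b t x / weight_den q b t x"

definition D_plus :: "(nat \<Rightarrow> complex) \<Rightarrow> complex \<Rightarrow> complex \<Rightarrow> complex" where
  "D_plus b t x = b 6 * (1 - b 1 * x) * (1 - b 4 * x) * (t - b 6 * x)"

definition D_minus :: "(nat \<Rightarrow> complex) \<Rightarrow> complex \<Rightarrow> complex \<Rightarrow> complex" where
  "D_minus b t x = (1 - b 2 * x) * (1 - b 3 * x) * (b 6 * t - x)"

definition E_plus :: "complex \<Rightarrow> (nat \<Rightarrow> complex) \<Rightarrow> complex \<Rightarrow> complex \<Rightarrow> complex" where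
  "E_plus q b t x = inverse (b 6) * (b 6 * q * t - x)"

definition E_minus :: "complex \<Rightarrow> (nat \<Rightarrow> complex) \<Rightarrow> complex \<Rightarrow> complex \<Rightarrow> complex" where
  "E_minus q b t x = q * t - b 6 * x"

definition jackson0 :: "complex \<Rightarrow> complex \<Rightarrow> (complex \<Rightarrow> complex) \<Rightarrow> complex" where
  "jackson0 q a f = (1 - q) * a * (\<Sum>k. q ^ k * f (a * q ^ k))"

text \<open>The Thomae--Jackson integral of \<open>f\<close> from \<open>a\<close> to \<open>c\<close>.\<close>

definition jackson :: "complex \<Rightarrow> complex \<Rightarrow> complex \<Rightarrow> (complex \<Rightarrow> complex) \<Rightarrow> complex" where
  "jackson q a c f = jackson0 q c f - jackson0 q a f"

definition jackson_support :: "complex \<Rightarrow> complex \<Rightarrow> complex \<Rightarrow> complex set" where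
  "jackson_support q a c = range (\<lambda>k::nat. a * q ^ k) \<union> range (\<lambda>k::nat. c * q ^ k)"

text \<open>The sum defining \<open>jackson0 q a\<close> contains the point \<open>a\<close> itself, so the boundary point is
  \<open>a / q\<close>. Since zeros and poles of the weight come in sequences closed under division by \<open>q\<close>, the
  condition below also holds whenever \<open>a\<close> itself is such a zero or pole. The second condition says
  that no pole of the weight is a point of summation.\<close>

definition admissible_terminals ::
  "complex \<Rightarrow> (nat \<Rightarrow> complex) \<Rightarrow> complex \<Rightarrow> complex \<Rightarrow> complex \<Rightarrow> bool" where
  "admissible_terminals q b a c t \<longleftrightarrow>
     (\<forall>e\<in>{a, c}. weight_num q b t (e / q) = 0 \<or> weight_den q b t (e / q) = 0) \<and>
     (\<forall>y\<in>jackson_support q a c. weight_den q b t y \<noteq> 0)"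

definition stieltjes ::
  "complex \<Rightarrow> (nat \<Rightarrow> complex) \<Rightarrow> complex \<Rightarrow> complex \<Rightarrow> complex \<Rightarrow> complex \<Rightarrow> complex" where
  "stieltjes q b a c t x = jackson q a c (\<lambda>y. weight q b t y / (x - y))"

text \<open>The two first-order equations of the Stieltjes function. The points \<open>0\<close> and those of the
  summation lattices are the singularities of the Stieltjes function. In the second
  equation the terminals are \<open>a, c\<close> at \<open>t\<close> and \<open>a', c'\<close> at \<open>q * t\<close>.\<close>

definition stieltjes_spectral_eq ::
  "complex \<Rightarrow> (nat \<Rightarrow> complex) \<Rightarrow> complex \<Rightarrow> complex \<Rightarrow> complex \<Rightarrow> bool" where
  "stieltjes_spectral_eq q b a c t \<longleftrightarrow>
     (\<exists>U :: complex poly. \<forall>x. x \<noteq> 0 \<and> x \<notin> jackson_support q a c \<and> q * x \<notin> jackson_support q a c \<longrightarrow>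
        D_minus b t x * stieltjes q b a c t (q * x) =
        D_plus b t x * stieltjes q b a c t x + (q - 1) * x * poly U x)"

definition stieltjes_deformation_eq ::
  "complex \<Rightarrow> (nat \<Rightarrow> complex) \<Rightarrow> complex \<Rightarrow> complex \<Rightarrow> complex \<Rightarrow> complex \<Rightarrow> complex \<Rightarrow> bool" where
  "stieltjes_deformation_eq q b a c a' c' t \<longleftrightarrow>
     (\<exists>T :: complex poly. \<forall>x. x \<noteq> 0 \<and> x \<notin> jackson_support q a c \<and> x \<notin> jackson_support q a' c' \<longrightarrow>
        E_minus q b t x * stieltjes q b a' c' (q * t) x =
        E_plus q b t x * stieltjes q b a c t x + (q - 1) * t * poly T x)"

definition orthonormal_system ::
  "complex \<Rightarrow> (nat \<Rightarrow> complex) \<Rightarrow> complex \<Rightarrow> complex \<Rightarrow> complex \<Rightarrow> (nat \<Rightarrow> complex poly) \<Rightarrow> bool" where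
  "orthonormal_system q b a c t p \<longleftrightarrow>
     (\<forall>n. p n \<noteq> 0 \<and> degree (p n) = n) \<and>
     (\<forall>n m. jackson q a c (\<lambda>y. weight q b t y * poly (p n) y * poly (p m) y) =
              (if n = m then 1 else 0))"

definition second_kind ::
  "complex \<Rightarrow> (nat \<Rightarrow> complex) \<Rightarrow> complex \<Rightarrow> complex \<Rightarrow> complex \<Rightarrow> complex poly \<Rightarrow> complex \<Rightarrow> complex" where
  "second_kind q b a c t pn x = jackson q a c (\<lambda>y. weight q b t y * poly pn y / (x - y))"

definition mat22 :: "'a \<Rightarrow> 'a \<Rightarrow> 'a \<Rightarrow> 'a \<Rightarrow> 'a::zero ^ 2 ^ 2" where
  "mat22 m11 m12 m21 m22 = vector [vector [m11, m12], vector [m21, m22]]"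

definition scale_mat :: "complex \<Rightarrow> complex ^ 2 ^ 2 \<Rightarrow> complex ^ 2 ^ 2" where
  "scale_mat k M = (\<chi> i j. k * M $ i $ j)"

definition eval_mat :: "complex poly ^ 2 ^ 2 \<Rightarrow> complex \<Rightarrow> complex ^ 2 ^ 2" where
  "eval_mat M x = (\<chi> i j. poly (M $ i $ j) x)"

definition Y_mat ::
  "complex \<Rightarrow> (nat \<Rightarrow> complex) \<Rightarrow> complex \<Rightarrow> complex \<Rightarrow> complex \<Rightarrow> (nat \<Rightarrow> complex poly) \<Rightarrow> nat \<Rightarrow>
     complex \<Rightarrow> complex ^ 2 ^ 2" where
  "Y_mat q b a c t p n x =
     mat22 (poly (p n) x)       (second_kind q b a c t (p n) x / weight q b t x)
           (poly (p (n - 1)) x) (second_kind q b a c t (p (n - 1)) x / weight q b t x)"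

text \<open>Points at which the entries of \<open>Y_mat\<close> are defined.\<close>

definition regular_point ::
  "complex \<Rightarrow> (nat \<Rightarrow> complex) \<Rightarrow> complex \<Rightarrow> complex \<Rightarrow> complex \<Rightarrow> complex \<Rightarrow> bool" where
  "regular_point q b a c t x \<longleftrightarrow>
     x \<noteq> 0 \<and> weight_num q b t x \<noteq> 0 \<and> weight_den q b t x \<noteq> 0 \<and> x \<notin> jackson_support q a c"

definition is_spectral_matrix ::
  "complex \<Rightarrow> (nat \<Rightarrow> complex) \<Rightarrow> complex \<Rightarrow> complex \<Rightarrow> complex \<Rightarrow> (nat \<Rightarrow> complex poly) \<Rightarrow> nat \<Rightarrow>
     complex poly ^ 2 ^ 2 \<Rightarrow> bool" where
  "is_spectral_matrix q b a c t p n A \<longleftrightarrow>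
     (\<forall>x. regular_point q b a c t x \<and> regular_point q b a c t (q * x) \<longrightarrow>
        scale_mat (D_plus b t x) (Y_mat q b a c t p n (q * x)) =
        eval_mat A x ** Y_mat q b a c t p n x)"

text \<open>Here \<open>a, c, p\<close> are the terminals and polynomials at \<open>t\<close>, and \<open>a', c', p'\<close> those at
  \<open>q * t\<close>.\<close>

definition is_deformation_matrix ::
  "complex \<Rightarrow> (nat \<Rightarrow> complex) \<Rightarrow> complex \<Rightarrow> complex \<Rightarrow> complex \<Rightarrow> complex \<Rightarrow> complex \<Rightarrow>
     (nat \<Rightarrow> complex poly) \<Rightarrow> (nat \<Rightarrow> complex poly) \<Rightarrow> nat \<Rightarrow> complex poly ^ 2 ^ 2 \<Rightarrow> bool" where
  "is_deformation_matrix q b a c a' c' t p p' n B \<longleftrightarrow>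
     (\<forall>x. regular_point q b a c t x \<and> regular_point q b a' c' (q * t) x \<longrightarrow>
        scale_mat (- E_plus q b t x) (Y_mat q b a' c' (q * t) p' n x) =
        eval_mat B x ** Y_mat q b a c t p n x)"

end

(* The entries of Y_n at different x and t are related by rows
     Kp(x) p'_m(kappa x) = M1(x) p_n(x) + M2(x) p_{n-1}(x)
   and the same with the functions of the second kind and Km. Here M1 and M2 are polynomials
   whose leading coefficients follow from the behaviour at infinity, whose values at 0 follow
   from the Stieltjes equations, and whose determinant follows from the Casoratian.
   This gives P_+ and P_- outright and leaves the constant terms of R_+ and R_-.

   The composite shift (x, t) -> (q x, q t) is again such a row C, now with the quadratic factors
   Kp = (1 - b1 x)(1 - b4 x) and Km = (1 - b2 x)(1 - b3 x). Writing B, A for the deformation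
   and spectral matrices, one has
     B(q x) A(x; t)  = -q (b6 t - x)(t - b6 x) C(x)
     A(x; q t) B(x)  = -(q t - b6 x)(b6 q t - x) C(x).
   The second identity at the zero of T_+(x; q t) identifies C_12 as P_+ (1 - f(t) x) / (q t).
   The first one at the zero g of T_+(x; t) then gives W_-(g), and comparing its two
   highest coefficients gives the constant term of R_+ in terms of the coefficients of W_-. These
   follow from W_+(g), W_-(g) and the determinant of A. The determinant of B
   gives R_-. *)

theory Submission
  imports Defs
begin

text \<open>The lattices of summation accumulate at the origin, and the matrix identities are given
  only where the weight and its reciprocal are finite. So neither the values at 0 nor those at a
  zero of an entry can be read off the definitions. The way round is that the Stieltjes equations
  produce, by Cramer's rule with a constant Casoratian, an explicit polynomial solution of each row,
  valid at all points off the lattices; infinitely many regular points identify the given entries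
  with it.

  The composite shift enters because it leaves x / t fixed: the infinite products in x / t drop out
  and cubic factors become quadratic. Its entry C_12 is therefore linear and is known once its
  values at two points are known. One of these is the zero of T_+(x; q t), because it is at q t that
  the defining relation of f involves f(t).

  The condition b5^2 \<noteq> 1/q makes P_+ nonzero, which is needed to cancel it when W_-(g) is
  computed.\<close>

section \<open>Bounded functions, and polynomials determined by their values near infinity\<close>

lemma bounded_combination:
  fixes h1 h2 :: "'a \<Rightarrow> 'b::real_normed_algebra"
  assumes "bounded (h1 ` S)" "bounded (h2 ` S)"
  shows "bounded ((\<lambda>y. k * h1 y + h2 y) ` S)"
proof -
  obtain A B where "\<And>y. y \<in> S \<Longrightarrow> norm (h1 y) \<le> A"
      "\<And>y. y \<in> S \<Longrightarrow> norm (h2 y) \<le> B"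
    using assms by (auto simp: bounded_iff)
  then have "norm (k * h1 y + h2 y) \<le> norm k * A + B" if "y \<in> S" for y
    using that by (intro norm_triangle_le add_mono order_trans[OF norm_mult_ineq] mult_left_mono) auto
  then show ?thesis by (intro boundedI) auto
qed

lemma tendsto_poly_over_power:
  fixes P :: "complex poly"
  assumes "degree P \<le> d"
  shows "((\<lambda>x. poly P x / x ^ d) \<longlongrightarrow> coeff P d) at_infinity"
proof (cases "degree P = d")
  case True
  then show ?thesis using poly_divide_tendsto_aux[of P] by simp
next
  case False
  with assms have "degree P < degree (monom (1::complex) d)" by (simp add: degree_monom_eq)
  from poly_divide_tendsto_0_at_infinity[OF this] show ?thesis
    using assms False by (simp add: poly_monom coeff_eq_0)
qed

text \<open>If the degree e exceeded d, dividing once more by x^(e - d) would give the limit 0,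
  although that quotient tends to the leading coefficient. All degree bounds and top coefficients of
  the matrix entries come from here.\<close>

lemma coeff_from_limit:
  fixes P :: "complex poly"
  assumes lim: "((\<lambda>x. poly P x / x ^ d) \<longlongrightarrow> c) at_infinity"
  shows "degree P \<le> d" "coeff P d = c"
proof -
  show deg: "degree P \<le> d"
  proof (rule ccontr)
    assume "\<not> degree P \<le> d"
    then have lt: "d < degree P" by simp
    have "((\<lambda>x. poly P x / x ^ d * (1 / x) ^ (degree P - d)) \<longlongrightarrow> c * 0 ^ (degree P - d)) at_infinity"
      by (intro tendsto_mult lim tendsto_power tendsto_divide_0[OF tendsto_const] filterlim_ident)
    moreover have "\<forall>\<^sub>F x in at_infinity. poly P x / x ^ d * (1 / x) ^ (degree P - d)
        = poly P x / x ^ degree P"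
    proof (rule eventually_at_infinityI[of 1])
      fix x :: complex assume "1 \<le> norm x"
      then have "x \<noteq> 0" by auto
      have "x ^ degree P = x ^ d * x ^ (degree P - d)"
        using lt by (simp flip: power_add)
      then show "poly P x / x ^ d * (1 / x) ^ (degree P - d) = poly P x / x ^ degree P"
        by (simp add: power_one_over divide_simps)
    qed
    ultimately have "((\<lambda>x. poly P x / x ^ degree P) \<longlongrightarrow> c * 0 ^ (degree P - d)) at_infinity"
      by (rule Lim_transform_eventually)
    from tendsto_unique[OF _ this poly_divide_tendsto_aux[of P]] lt
    have "lead_coeff P = 0" by (simp add: zero_power trivial_limit_at_infinity)
    with lt show False by simp
  qed
  show "coeff P d = c"
    using tendsto_unique[OF _ tendsto_poly_over_power[OF deg] lim]
    by (simp add: trivial_limit_at_infinity)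
qed

lemma poly_eqI_infinite:
  fixes P Q :: "complex poly"
  assumes "infinite X" "\<And>x. x \<in> X \<Longrightarrow> poly P x = poly Q x"
  shows "P = Q"
proof (rule ccontr)
  assume "P \<noteq> Q"
  then have "finite {x. poly (P - Q) x = 0}" by (intro poly_roots_finite) simp
  moreover have "X \<subseteq> {x. poly (P - Q) x = 0}" using assms(2) by auto
  ultimately show False using assms(1) finite_subset by blast
qed

lemma poly_eqI_at_infinity:
  fixes P Q :: "complex poly"
  assumes "\<forall>\<^sub>F x in at_infinity. poly P x = poly Q x"
  shows "P = Q"
proof -
  have "\<forall>\<^sub>F x in at_infinity. 0 = poly (P - Q) x / x ^ 0"
    using assms by eventually_elim simp
  then have "((\<lambda>x. poly (P - Q) x / x ^ 0) \<longlongrightarrow> 0) at_infinity"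
    by (rule Lim_transform_eventually[OF tendsto_const])
  from coeff_from_limit[OF this] have "P - Q = 0"
    by (metis bot_nat_0.extremum_uniqueI leading_coeff_0_iff)
  then show ?thesis by simp
qed

section \<open>Moment functionals, Stieltjes functions and functions of the second kind\<close>

text \<open>An abstraction of integration against the weight. Linearity is confined to functions
  bounded on \<open>S\<close>, for which the defining series converge; 0 is adjoined to
  \<open>S\<close> because the lattices accumulate there.\<close>

locale moment_functional =
  fixes L :: "(complex \<Rightarrow> complex) \<Rightarrow> complex" and S :: "complex set"
  assumes linear: "bounded (h1 ` S) \<Longrightarrow> bounded (h2 ` S) \<Longrightarrow>
      L (\<lambda>y. k * h1 y + h2 y) = k * L h1 + L h2"
    and bounded_op: "\<exists>M. \<forall>h K. (\<forall>y\<in>S. norm (h y) \<le> K) \<longrightarrow> norm (L h) \<le> M * K"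
    and bounded_support: "bounded S"
    and closed_support: "closed (insert 0 S)"
begin

text \<open>The function of the second kind belonging to P. The case P = 1 is the Stieltjes
  function.\<close>

definition Q :: "complex poly \<Rightarrow> complex \<Rightarrow> complex" where
  "Q P x = L (\<lambda>y. poly P y / (x - y))"

definition \<phi> :: "complex \<Rightarrow> complex" where
  "\<phi> = Q 1"

lemma bounded_poly: "bounded (poly P ` S)"
proof -
  have "compact (closure S)" using bounded_support by simp
  then have "compact (poly P ` closure S)"
    by (intro compact_continuous_image continuous_intros)
  then show ?thesis
    using closure_subset[of S] by (meson bounded_subset compact_imp_bounded image_mono)
qed

lemma bounded_kernel:
  assumes "x \<notin> insert 0 S"
  shows "bounded ((\<lambda>y. 1 / (x - y)) ` S)"
proof -
  have "open (- insert 0 S)" using closed_support by (simp add: open_Compl)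
  then obtain e where e: "e > 0" "ball x e \<subseteq> - insert 0 S"
    using assms by (meson ComplI open_contains_ball)
  show ?thesis
  proof (rule boundedI[of _ "1 / e"])
    fix z assume "z \<in> (\<lambda>y. 1 / (x - y)) ` S"
    then obtain y where y: "y \<in> S" "z = 1 / (x - y)" by auto
    then have "y \<notin> ball x e" using e by auto
    then have "e \<le> norm (x - y)" by (simp add: dist_norm)
    then show "norm z \<le> 1 / e" using e y by (simp add: norm_divide frac_le)
  qed
qed

text \<open>Off the closed set the distance from x to the support is bounded below uniformly for x
  near z. The bound serves to divide a linear factor out of the composite Stieltjes
  equation.\<close>

lemma \<phi>_locally_bounded:
  assumes "z \<notin> insert 0 S"
  shows "\<exists>e>0. \<exists>K. \<forall>x\<in>ball z e. norm (\<phi> x) \<le> K"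
proof -
  obtain M where M: "\<And>h K. (\<forall>y\<in>S. norm (h y) \<le> K) \<Longrightarrow> norm (L h) \<le> M * K"
    using bounded_op by blast
  have "open (- insert 0 S)" using closed_support by (simp add: open_Compl)
  then obtain e where e: "e > 0" "ball z e \<subseteq> - insert 0 S"
    using assms by (meson ComplI open_contains_ball)
  have "norm (\<phi> x) \<le> M * (1 / (e / 2))" if x: "x \<in> ball z (e / 2)" for x
    unfolding \<phi>_def Q_def
  proof (rule M, rule ballI)
    fix y assume "y \<in> S"
    then have "y \<notin> ball z e" using e by auto
    then have "e / 2 \<le> norm (x - y)"
      using x dist_triangle[of z y x] by (simp add: dist_norm)
    then show "norm (poly 1 y / (x - y)) \<le> 1 / (e / 2)"
      unfolding norm_divide using e by (intro frac_le) auto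
  qed
  then show ?thesis using e by (metis half_gt_zero)
qed

lemma bounded_poly_kernel:
  assumes "x \<notin> insert 0 S"
  shows "bounded ((\<lambda>y. poly P y / (x - y)) ` S)"
proof -
  obtain A where A: "\<And>y. y \<in> S \<Longrightarrow> norm (poly P y) \<le> A"
    using bounded_poly[of P] by (auto simp: bounded_iff)
  obtain B where B: "\<And>y. y \<in> S \<Longrightarrow> norm (1 / (x - y)) \<le> B"
    using bounded_kernel[OF assms] by (auto simp: bounded_iff)
  show ?thesis
  proof (rule boundedI[of _ "A * B"])
    fix z assume "z \<in> (\<lambda>y. poly P y / (x - y)) ` S"
    then obtain y where y: "y \<in> S" "z = poly P y * (1 / (x - y))" by auto
    have "0 \<le> A" using A[OF y(1)] norm_ge_zero order_trans by blast
    then show "norm z \<le> A * B"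
      unfolding y(2) norm_mult using A[OF y(1)] B[OF y(1)] by (intro mult_mono) auto
  qed
qed

text \<open>The functional acts on functions of the whole plane. That it sees only their values on
  \<open>S\<close> follows from the norm bound with K = 0, applied to the difference.\<close>

lemma cong:
  assumes "\<And>y. y \<in> S \<Longrightarrow> h1 y = h2 y" "bounded (h1 ` S)"
  shows "L h1 = L h2"
proof -
  obtain M where M: "\<And>h K. (\<forall>y\<in>S. norm (h y) \<le> K) \<Longrightarrow> norm (L h) \<le> M * K"
    using bounded_op by blast
  have b2: "bounded (h2 ` S)" using assms by (metis image_cong)
  have "norm (L (\<lambda>y. (-1) * h1 y + h2 y)) \<le> M * 0"
    by (rule M) (use assms in simp)
  moreover have "L (\<lambda>y. (-1) * h1 y + h2 y) = (-1) * L h1 + L h2"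
    by (rule linear[OF assms(2) b2])
  ultimately show ?thesis by simp
qed

lemma zero: "L (\<lambda>y. 0) = 0"
  using linear[of "\<lambda>y. 0" "\<lambda>y. 0" 1] by (simp add: image_constant_conv)

lemma scale: "bounded (h ` S) \<Longrightarrow> L (\<lambda>y. k * h y) = k * L h"
  using linear[of h "\<lambda>y. 0" k] zero by (simp add: image_constant_conv)

lemma L_poly_add: "L (poly (P + R)) = L (poly P) + L (poly R)"
  using linear[OF bounded_poly bounded_poly, of 1 P R] by (simp add: poly_add[abs_def])

lemma L_poly_smult: "L (poly (smult c P)) = c * L (poly P)"
  using scale[OF bounded_poly, of c P] by (simp add: poly_smult[abs_def])

text \<open>From (a + y P(y)) / (x - y) = a / (x - y) - P(y) + x P(y) / (x - y). This Horner step
  drives both the decomposition of \<open>Q P\<close> and its decay at infinity.\<close>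

lemma Q_pCons:
  assumes x: "x \<notin> insert 0 S"
  shows "Q (pCons a P) x = a * \<phi> x - L (poly P) + x * Q P x"
proof -
  have bk: "bounded ((\<lambda>y. poly 1 y / (x - y)) ` S)"
    and bP: "bounded ((\<lambda>y. poly P y / (x - y)) ` S)"
    and bC: "bounded ((\<lambda>y. poly (pCons a P) y / (x - y)) ` S)"
    using bounded_poly_kernel[OF x] by blast+
  have b2: "bounded ((\<lambda>y. (-1) * poly P y + 0) ` S)"
    using bounded_poly[of "- P"] by simp
  have b3: "bounded ((\<lambda>y. x * (poly P y / (x - y)) + ((-1) * poly P y + 0)) ` S)"
    by (rule bounded_combination[OF bP b2])
  have "Q (pCons a P) x
      = L (\<lambda>y. a * (poly 1 y / (x - y)) + (x * (poly P y / (x - y)) + ((-1) * poly P y + 0)))"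
    unfolding Q_def
  proof (rule cong)
    fix y assume "y \<in> S"
    then have "x - y \<noteq> 0" using x by auto
    then show "poly (pCons a P) y / (x - y) =
        a * (poly 1 y / (x - y)) + (x * (poly P y / (x - y)) + ((-1) * poly P y + 0))"
      by (simp add: divide_simps) (simp add: algebra_simps)
  qed (rule bC)
  also have "\<dots> = a * \<phi> x + (x * Q P x + ((-1) * L (poly P) + L (\<lambda>y. 0)))"
    unfolding \<phi>_def Q_def
    by (subst linear[OF bk b3], subst linear[OF bP b2], subst linear[OF bounded_poly])
       (simp_all add: image_constant_conv)
  finally show ?thesis by (simp add: zero)
qed

text \<open>The associated polynomial L((P(x) - P(y)) / (x - y)), with L acting in y. It is picked
  by the decomposition it has to satisfy; existence follows by recursion on the coefficients of
  P.\<close>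

definition assoc_poly :: "complex poly \<Rightarrow> complex poly" where
  "assoc_poly P = (SOME r. \<forall>x. x \<notin> insert 0 S \<longrightarrow> Q P x = poly P x * \<phi> x - poly r x)"

lemma Q_decomp:
  assumes "x \<notin> insert 0 S"
  shows "Q P x = poly P x * \<phi> x - poly (assoc_poly P) x"
proof -
  have "\<exists>r. \<forall>x. x \<notin> insert 0 S \<longrightarrow> Q P x = poly P x * \<phi> x - poly r x"
  proof (induction P)
    case 0
    have "Q 0 x = 0" for x by (simp add: Q_def zero)
    then show ?case by (intro exI[of _ 0]) simp
  next
    case (pCons a P)
    then obtain r where r: "\<And>x. x \<notin> insert 0 S \<Longrightarrow> Q P x = poly P x * \<phi> x - poly r x" by blast
    have "Q (pCons a P) x = poly (pCons a P) x * \<phi> x - poly (pCons (L (poly P)) r) x"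
      if "x \<notin> insert 0 S" for x
      unfolding Q_pCons[OF that] r[OF that] by (simp add: algebra_simps)
    then show ?case by blast
  qed
  from someI_ex[OF this] assms show ?thesis unfolding assoc_poly_def by blast
qed

lemma eventually_off_support: "\<forall>\<^sub>F x in at_infinity. x \<notin> insert 0 S"
proof -
  obtain R where "\<And>y. y \<in> insert 0 S \<Longrightarrow> norm y \<le> R"
    using bounded_support by (metis bounded_iff bounded_insert)
  then show ?thesis
    by (intro eventually_at_infinityI[of "R + 1"]) force
qed

lemma Q_tendsto_0: "(Q P \<longlongrightarrow> 0) at_infinity"
proof -
  obtain M where M: "\<And>h K. (\<forall>y\<in>S. norm (h y) \<le> K) \<Longrightarrow> norm (L h) \<le> M * K"
    using bounded_op by blast
  obtain A where A: "\<And>y. y \<in> S \<Longrightarrow> norm (poly P y) \<le> A"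
    using bounded_poly[of P] by (auto simp: bounded_iff)
  obtain R where R: "\<And>y. y \<in> S \<Longrightarrow> norm y \<le> R"
    using bounded_support by (auto simp: bounded_iff)
  have "\<forall>\<^sub>F x in at_infinity. norm (Q P x) \<le> M * (\<bar>A\<bar> / (norm x - R))"
  proof (rule eventually_at_infinityI[of "R + 1"])
    fix x :: complex assume x: "R + 1 \<le> norm x"
    show "norm (Q P x) \<le> M * (\<bar>A\<bar> / (norm x - R))"
      unfolding Q_def
    proof (rule M, rule ballI)
      fix y assume y: "y \<in> S"
      have "norm x - R \<le> norm (x - y)"
        using R[OF y] norm_triangle_ineq2[of x y] by linarith
      then show "norm (poly P y / (x - y)) \<le> \<bar>A\<bar> / (norm x - R)"
        unfolding norm_divide using x A[OF y] by (intro frac_le) auto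
    qed
  qed
  moreover have "((\<lambda>x::complex. M * (\<bar>A\<bar> / (norm x - R))) \<longlongrightarrow> M * 0) at_infinity"
  proof (intro tendsto_mult tendsto_const)
    have "filterlim (\<lambda>x::complex. - R + norm x) at_top at_infinity"
      by (intro filterlim_tendsto_add_at_top[OF tendsto_const] filterlim_norm_at_top)
    then have "filterlim (\<lambda>x::complex. norm x - R) at_infinity at_infinity"
      by (intro filterlim_at_top_imp_at_infinity) simp
    then show "((\<lambda>x::complex. \<bar>A\<bar> / (norm x - R)) \<longlongrightarrow> 0) at_infinity"
      by (intro tendsto_divide_0[OF tendsto_const])
  qed
  ultimately show ?thesis
    by (intro Lim_null_comparison[of "Q P"]) auto
qed

text \<open>By \<open>Q_pCons\<close>, x Q(P) = Q(x P) + L(P): each factor x costs one moment, and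
  the hypothesis makes the first m of them vanish.\<close>

lemma power_times_Q:
  assumes "\<And>j. j < m \<Longrightarrow> L (poly (monom 1 j * P)) = 0" "x \<notin> insert 0 S"
  shows "x ^ m * Q P x = Q (monom 1 m * P) x"
  using assms(1)
proof (induction m)
  case (Suc m)
  have eq: "monom 1 (Suc m) * P = pCons 0 (monom 1 m * P)" by (simp add: monom_Suc)
  have "L (poly (monom 1 m * P)) = 0" by (rule Suc.prems) simp
  then have "Q (monom 1 (Suc m) * P) x = x * Q (monom 1 m * P) x"
    unfolding eq Q_pCons[OF assms(2)] by simp
  also have "Q (monom 1 m * P) x = x ^ m * Q P x"
    using Suc by simp
  finally show ?case by simp
qed simp

end

section \<open>Orthonormal polynomials and their Casoratian\<close>

locale orthonormal_polys = moment_functional +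
  fixes p :: "nat \<Rightarrow> complex poly"
  assumes nonzero: "p n \<noteq> 0"
    and degree: "degree (p n) = n"
    and orthonormal: "L (poly (p n * p m)) = (if n = m then 1 else 0)"
begin

abbreviation \<gamma> :: "nat \<Rightarrow> complex" where
  "\<gamma> m \<equiv> lead_coeff (p m)"

lemma \<gamma>_nonzero: "\<gamma> n \<noteq> 0"
  using nonzero by simp

lemma orthogonal_lower:
  assumes "degree P < n"
  shows "L (poly (P * p n)) = 0"
  using assms
proof (induction "degree P" arbitrary: P rule: less_induct)
  case less
  define d c R where "d = degree P" and "c = lead_coeff P / \<gamma> d" and "R = P - smult c (p d)"
  have P: "P = smult c (p d) + R" by (simp add: R_def)
  have dR: "degree R \<le> d" "coeff R d = 0"
    unfolding R_def using degree \<gamma>_nonzero[of d]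
    by (auto intro!: degree_diff_le order_trans[OF degree_smult_le] simp: d_def c_def)
  have "L (poly (R * p n)) = 0"
  proof (cases "R = 0")
    case True
    then show ?thesis using L_poly_smult[of 0 0] by simp
  next
    case False
    then have "degree R < d"
      using dR by (metis leading_coeff_0_iff le_neq_implies_less)
    then show ?thesis using less by (simp add: d_def)
  qed
  moreover have "L (poly (smult c (p d) * p n)) = 0"
    using less.prems L_poly_smult[of c "p d * p n"] orthonormal by (simp add: d_def)
  ultimately show ?case
    using L_poly_add[of "smult c (p d) * p n" "R * p n"] P by (simp add: distrib_right)
qed

text \<open>Up to a polynomial of lower degree, x^n is p_n divided by its leading
  coefficient.\<close>

lemma top_moment: "L (poly (monom 1 n * p n)) = 1 / \<gamma> n"
proof -
  define R where "R = monom 1 n - smult (1 / \<gamma> n) (p n)"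
  have P: "monom 1 n = smult (1 / \<gamma> n) (p n) + R" by (simp add: R_def)
  have dR: "degree R \<le> n" "coeff R n = 0"
    unfolding R_def using degree \<gamma>_nonzero
    by (auto intro!: degree_diff_le order_trans[OF degree_smult_le] simp: degree_monom_le)
  have "L (poly (R * p n)) = 0"
  proof (cases "R = 0")
    case True
    then show ?thesis using L_poly_smult[of 0 0] by simp
  next
    case False
    then have "degree R < n"
      using dR by (metis leading_coeff_0_iff le_neq_implies_less)
    then show ?thesis by (rule orthogonal_lower)
  qed
  moreover have "L (poly (smult (1 / \<gamma> n) (p n) * p n)) = 1 / \<gamma> n"
    using L_poly_smult[of "1 / \<gamma> n" "p n * p n"] orthonormal by simp
  ultimately show ?thesis
    using L_poly_add[of "smult (1 / \<gamma> n) (p n) * p n" "R * p n"] P by (simp add: distrib_right)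
qed

text \<open>Orthogonality absorbs n powers of x under the functional. One more power leaves the top
  moment and a remainder that tends to 0.\<close>

lemma Q_asymp: "((\<lambda>x. x ^ (n + 1) * Q (p n) x) \<longlongrightarrow> 1 / \<gamma> n) at_infinity"
proof -
  let ?P = "monom 1 n * p n"
  have "\<forall>\<^sub>F x in at_infinity. L (poly ?P) + Q (pCons 0 ?P) x = x ^ (n + 1) * Q (p n) x"
    using eventually_off_support
  proof eventually_elim
    case (elim x)
    have "x ^ n * Q (p n) x = Q ?P x"
      using elim by (intro power_times_Q orthogonal_lower) (auto simp: degree_monom_eq)
    then show ?case using Q_pCons[OF elim, of 0 ?P] by (simp add: mult.assoc)
  qed
  moreover have "((\<lambda>x. L (poly ?P) + Q (pCons 0 ?P) x) \<longlongrightarrow> 1 / \<gamma> n + 0) at_infinity"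
    unfolding top_moment[symmetric] by (intro tendsto_add tendsto_const Q_tendsto_0)
  ultimately show ?thesis using Lim_transform_eventually by fastforce
qed

lemma p_asymp:
  assumes "\<kappa> \<noteq> 0"
  shows "((\<lambda>x. poly (p n) (\<kappa> * x) / x ^ n) \<longlongrightarrow> \<gamma> n * \<kappa> ^ n) at_infinity"
proof -
  have "((\<lambda>x. poly (pcompose (p n) [:0, \<kappa>:]) x / x ^ n) \<longlongrightarrow> coeff (pcompose (p n) [:0, \<kappa>:]) n) at_infinity"
    using assms degree by (intro tendsto_poly_over_power) (simp add: degree_pcompose)
  moreover have "coeff (pcompose (p n) [:0, \<kappa>:]) n = \<gamma> n * \<kappa> ^ n"
    using lead_coeff_comp[of "[:0, \<kappa>:]" "p n"] assms degree by (simp add: degree_pcompose)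
  ultimately show ?thesis by (simp add: poly_pcompose mult.commute)
qed

lemma Q_scaled_asymp:
  assumes "\<kappa> \<noteq> 0"
  shows "((\<lambda>x. x ^ (n + 1) * Q (p n) (\<kappa> * x)) \<longlongrightarrow> 1 / (\<gamma> n * \<kappa> ^ (n + 1))) at_infinity"
proof -
  have "filterlim (\<lambda>x. \<kappa> * x) at_infinity at_infinity"
    using assms by (intro tendsto_mult_filterlim_at_infinity[OF tendsto_const] filterlim_ident)
  from filterlim_compose[OF Q_asymp this]
  have "((\<lambda>x. 1 / \<kappa> ^ (n + 1) * ((\<kappa> * x) ^ (n + 1) * Q (p n) (\<kappa> * x))) \<longlongrightarrow>
      1 / \<kappa> ^ (n + 1) * (1 / \<gamma> n)) at_infinity"
    by (intro tendsto_mult tendsto_const)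
  moreover have "1 / \<kappa> ^ (n + 1) * ((\<kappa> * x) ^ (n + 1) * z) = x ^ (n + 1) * z" for x z
    using assms by (simp add: power_mult_distrib)
  ultimately show ?thesis by (simp add: mult.commute)
qed

end

lemma inverse_square_tendsto_0: "((\<lambda>x::complex. (1 / x)\<^sup>2) \<longlongrightarrow> 0\<^sup>2) at_infinity"
  by (intro tendsto_power tendsto_divide_0[OF tendsto_const] filterlim_ident)

context orthonormal_polys
begin

text \<open>The left side equals p_{k+1} Q(p_k) - p_k Q(p_{k+1}) off the support, since \<phi>
  cancels there. It is thus a polynomial with a finite limit at infinity, hence constant. Its value
  is w det Y_{k+1}.\<close>

lemma casoratian_poly:
  "p k * assoc_poly (p (Suc k)) - p (Suc k) * assoc_poly (p k) = [:\<gamma> (Suc k) / \<gamma> k:]"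
  (is "?C = _")
proof -
  have "((\<lambda>x. poly (p (Suc k)) (1 * x) / x ^ Suc k * (x ^ (k + 1) * Q (p k) x)
      - poly (p k) (1 * x) / x ^ k * (x ^ (Suc k + 1) * Q (p (Suc k)) x) * (1 / x) ^ 2)
    \<longlongrightarrow> \<gamma> (Suc k) * 1 ^ Suc k * (1 / \<gamma> k) - \<gamma> k * 1 ^ k * (1 / \<gamma> (Suc k)) * 0 ^ 2) at_infinity"
    by (rule tendsto_diff[OF tendsto_mult[OF p_asymp[OF one_neq_zero] Q_asymp]
          tendsto_mult[OF tendsto_mult[OF p_asymp[OF one_neq_zero] Q_asymp] inverse_square_tendsto_0]])
  moreover have "\<forall>\<^sub>F x in at_infinity. poly (p (Suc k)) (1 * x) / x ^ Suc k * (x ^ (k + 1) * Q (p k) x)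
      - poly (p k) (1 * x) / x ^ k * (x ^ (Suc k + 1) * Q (p (Suc k)) x) * (1 / x) ^ 2 = poly ?C x / x ^ 0"
    using eventually_off_support
  proof eventually_elim
    case (elim x)
    then have "x \<noteq> 0" by auto
    then show ?case
      unfolding Q_decomp[OF elim] by (simp add: divide_simps power2_eq_square) (simp add: algebra_simps)
  qed
  ultimately have "((\<lambda>x. poly ?C x / x ^ 0) \<longlongrightarrow> \<gamma> (Suc k) / \<gamma> k) at_infinity"
    by (rule Lim_transform_eventually[THEN tendsto_eq_rhs]) simp
  note lim = coeff_from_limit[OF this]
  then obtain a where "?C = [:a:]" by (metis degree_eq_zeroE le_zero_eq)
  with lim(2) show ?thesis by (simp only: coeff_pCons_0)
qed

lemma casoratian:
  assumes "x \<notin> insert 0 S"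
  shows "poly (p (Suc k)) x * Q (p k) x - poly (p k) x * Q (p (Suc k)) x = \<gamma> (Suc k) / \<gamma> k"
  using arg_cong[OF casoratian_poly[of k], of "\<lambda>P. poly P x"]
  unfolding Q_decomp[OF assms] by (simp add: algebra_simps)

text \<open>A linear system in u and v whose determinant is the nonzero Casoratian. It allows the
  coefficients of row identities to be compared point by point.\<close>

lemma casoratian_cancel:
  assumes "x \<notin> insert 0 S"
    and "u * poly (p (Suc k)) x + v * poly (p k) x = 0"
    and "u * Q (p (Suc k)) x + v * Q (p k) x = 0"
  shows "u = 0" "v = 0"
proof -
  have ne: "\<gamma> (Suc k) / \<gamma> k \<noteq> 0" using \<gamma>_nonzero by simp
  have "u * (poly (p (Suc k)) x * Q (p k) x - poly (p k) x * Q (p (Suc k)) x) = 0"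
    using assms(2,3) by algebra
  then show "u = 0" using ne unfolding casoratian[OF assms(1)] by simp
  have "v * (poly (p (Suc k)) x * Q (p k) x - poly (p k) x * Q (p (Suc k)) x) = 0"
    using assms(2,3) by algebra
  then show "v = 0" using ne unfolding casoratian[OF assms(1)] by simp
qed

end

section \<open>Connection rows between two orthonormal systems\<close>

text \<open>The index k stands for n - 1. The spectral shift pairs a system with itself; the
  deformation and the composite shift pair the systems at t and q t.\<close>

locale orthonormal_pair =
  M: orthonormal_polys L S p + M': orthonormal_polys L' S' p'
  for L S p L' S' p' +
  fixes k :: nat
begin

definition generic :: "complex \<Rightarrow> complex set" where
  "generic \<kappa> = {x. x \<notin> insert 0 S \<and> \<kappa> * x \<notin> insert 0 S'}"

text \<open>The pair \<open>M1, M2\<close> is a row of a connection matrix taking \<open>Y\<^sub>k\<^sub>+\<^sub>1\<close> of the first system at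
  \<open>x\<close> to the row with index \<open>m\<close> of the second system at \<open>\<kappa> x\<close>. The weight has been multiplied out of
  the second column, which is why \<open>Km\<close> replaces \<open>Kp\<close> there.\<close>

definition row ::
  "complex \<Rightarrow> complex poly \<Rightarrow> complex poly \<Rightarrow> nat \<Rightarrow> complex poly \<Rightarrow> complex poly \<Rightarrow> complex \<Rightarrow> bool" where
  "row \<kappa> Kp Km m M1 M2 x \<longleftrightarrow>
     poly Kp x * poly (p' m) (\<kappa> * x) = poly M1 x * poly (p (Suc k)) x + poly M2 x * poly (p k) x \<and>
     poly Km x * M'.Q (p' m) (\<kappa> * x) = poly M1 x * M.Q (p (Suc k)) x + poly M2 x * M.Q (p k) x"

lemma eventually_generic:
  assumes "\<kappa> \<noteq> 0"
  shows "\<forall>\<^sub>F x in at_infinity. x \<in> generic \<kappa>"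
proof -
  have "filterlim (\<lambda>x. \<kappa> * x) at_infinity at_infinity"
    using assms by (intro tendsto_mult_filterlim_at_infinity[OF tendsto_const] filterlim_ident)
  from eventually_compose_filterlim[OF M'.eventually_off_support this] M.eventually_off_support
  show ?thesis by eventually_elim (simp add: generic_def)
qed

text \<open>Cramer's rule for the two equations of \<open>row\<close>, with the inverse Casoratian
  in front. N is the inhomogeneous term in Km \<phi>'(\<kappa> x) = Kp \<phi>(x) + N; inserting that
  equation eliminates both Stieltjes functions, so that polynomials remain.\<close>

definition row_poly1 ::
  "complex \<Rightarrow> complex poly \<Rightarrow> complex poly \<Rightarrow> complex poly \<Rightarrow> nat \<Rightarrow> complex poly" where
  "row_poly1 \<kappa> Kp Km N m = smult (M.\<gamma> k / M.\<gamma> (Suc k))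
     (- Kp * pcompose (p' m) [:0, \<kappa>:] * M.assoc_poly (p k)
      - N * pcompose (p' m) [:0, \<kappa>:] * p k
      + Km * pcompose (M'.assoc_poly (p' m)) [:0, \<kappa>:] * p k)"

definition row_poly2 ::
  "complex \<Rightarrow> complex poly \<Rightarrow> complex poly \<Rightarrow> complex poly \<Rightarrow> nat \<Rightarrow> complex poly" where
  "row_poly2 \<kappa> Kp Km N m = smult (M.\<gamma> k / M.\<gamma> (Suc k))
     (N * pcompose (p' m) [:0, \<kappa>:] * p (Suc k)
      - Km * pcompose (M'.assoc_poly (p' m)) [:0, \<kappa>:] * p (Suc k)
      + Kp * pcompose (p' m) [:0, \<kappa>:] * M.assoc_poly (p (Suc k)))"

lemma row_exists:
  assumes x: "x \<in> generic \<kappa>"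
    and N: "poly Km x * M'.\<phi> (\<kappa> * x) = poly Kp x * M.\<phi> x + poly N x"
  shows "row \<kappa> Kp Km m (row_poly1 \<kappa> Kp Km N m) (row_poly2 \<kappa> Kp Km N m) x"
proof -
  define P R where "P = poly (p' m) (\<kappa> * x)" and "R = poly (M'.assoc_poly (p' m)) (\<kappa> * x)"
  define c where "c = M.\<gamma> k / M.\<gamma> (Suc k)"
  have off: "x \<notin> insert 0 S" "\<kappa> * x \<notin> insert 0 S'" using x by (auto simp: generic_def)
  note d = M.Q_decomp[OF off(1)] M'.Q_decomp[OF off(2)]
  have c: "c * (poly (p k) x * poly (M.assoc_poly (p (Suc k))) x
      - poly (p (Suc k)) x * poly (M.assoc_poly (p k)) x) = 1"
    using arg_cong[OF M.casoratian_poly[of k], of "\<lambda>P. poly P x"] M.\<gamma>_nonzero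
    by (simp add: c_def)
  have 1: "poly (row_poly1 \<kappa> Kp Km N m) x = c * (- poly Kp x * P * poly (M.assoc_poly (p k)) x
      - poly N x * P * poly (p k) x + poly Km x * R * poly (p k) x)"
    and 2: "poly (row_poly2 \<kappa> Kp Km N m) x = c * (poly N x * P * poly (p (Suc k)) x
      - poly Km x * R * poly (p (Suc k)) x + poly Kp x * P * poly (M.assoc_poly (p (Suc k))) x)"
    unfolding row_poly1_def row_poly2_def c_def P_def R_def by (simp_all add: poly_pcompose mult.commute)
  show ?thesis
    unfolding row_def d P_def[symmetric] R_def[symmetric] 1 2
    using c N by algebra
qed

text \<open>At each point the Casoratian fixes the values, and infinitely many values fix the
  polynomials. Entries known on a mere part of the plane are thereby identified with the explicit
  solution.\<close>

lemma row_unique: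
  assumes X: "infinite X" "X \<subseteq> generic \<kappa>"
    and r: "\<And>x. x \<in> X \<Longrightarrow> row \<kappa> Kp Km m M1 M2 x" "\<And>x. x \<in> X \<Longrightarrow> row \<kappa> Kp Km m N1 N2 x"
  shows "M1 = N1" "M2 = N2"
proof -
  have "poly M1 x = poly N1 x \<and> poly M2 x = poly N2 x" if x: "x \<in> X" for x
  proof -
    have off: "x \<notin> insert 0 S" using X x by (auto simp: generic_def)
    have "(poly M1 x - poly N1 x) * poly (p (Suc k)) x + (poly M2 x - poly N2 x) * poly (p k) x = 0"
      "(poly M1 x - poly N1 x) * M.Q (p (Suc k)) x + (poly M2 x - poly N2 x) * M.Q (p k) x = 0"
      using r[OF x] unfolding row_def by algebra+
    from M.casoratian_cancel[OF off this] show ?thesis by simp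
  qed
  then show "M1 = N1" "M2 = N2" using poly_eqI_infinite[OF X(1)] by blast+
qed

text \<open>Cramer's rule again, this time keeping the functions of the second kind, whose decay at
  infinity is known.\<close>

lemma row_entries:
  assumes x: "x \<in> generic \<kappa>" and r: "row \<kappa> Kp Km m M1 M2 x"
  shows "poly M1 x = M.\<gamma> k / M.\<gamma> (Suc k) *
      (poly Kp x * poly (p' m) (\<kappa> * x) * M.Q (p k) x - poly Km x * M'.Q (p' m) (\<kappa> * x) * poly (p k) x)"
    and "poly M2 x = M.\<gamma> k / M.\<gamma> (Suc k) *
      (poly Km x * M'.Q (p' m) (\<kappa> * x) * poly (p (Suc k)) x
        - poly Kp x * poly (p' m) (\<kappa> * x) * M.Q (p (Suc k)) x)"
proof -
  define c where "c = M.\<gamma> k / M.\<gamma> (Suc k)"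
  have off: "x \<notin> insert 0 S" using x by (auto simp: generic_def)
  have c: "c * (poly (p (Suc k)) x * M.Q (p k) x - poly (p k) x * M.Q (p (Suc k)) x) = 1"
    using M.casoratian[OF off, of k] M.\<gamma>_nonzero by (simp add: c_def)
  show "poly M1 x = M.\<gamma> k / M.\<gamma> (Suc k) *
      (poly Kp x * poly (p' m) (\<kappa> * x) * M.Q (p k) x - poly Km x * M'.Q (p' m) (\<kappa> * x) * poly (p k) x)"
    "poly M2 x = M.\<gamma> k / M.\<gamma> (Suc k) *
      (poly Km x * M'.Q (p' m) (\<kappa> * x) * poly (p (Suc k)) x
        - poly Kp x * poly (p' m) (\<kappa> * x) * M.Q (p (Suc k)) x)"
    unfolding c_def[symmetric] using r c unfolding row_def by algebra+
qed

text \<open>Both sides of the pair of rows have Casoratians as determinants, and the two columns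
  carry the extra factors Kp and Km.\<close>

lemma row_det:
  assumes x: "x \<in> generic \<kappa>"
    and r1: "row \<kappa> Kp Km (Suc k) M11 M12 x" and r2: "row \<kappa> Kp Km k M21 M22 x"
  shows "poly M11 x * poly M22 x - poly M12 x * poly M21 x
    = M.\<gamma> k / M.\<gamma> (Suc k) * (M'.\<gamma> (Suc k) / M'.\<gamma> k) * poly Kp x * poly Km x"
proof -
  define c where "c = M.\<gamma> k / M.\<gamma> (Suc k)"
  define c' where "c' = M'.\<gamma> (Suc k) / M'.\<gamma> k"
  have off: "x \<notin> insert 0 S" "\<kappa> * x \<notin> insert 0 S'" using x by (auto simp: generic_def)
  have c: "c * (poly (p (Suc k)) x * M.Q (p k) x - poly (p k) x * M.Q (p (Suc k)) x) = 1"
    using M.casoratian[OF off(1), of k] M.\<gamma>_nonzero by (simp add: c_def)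
  have c': "poly (p' (Suc k)) (\<kappa> * x) * M'.Q (p' k) (\<kappa> * x)
      - poly (p' k) (\<kappa> * x) * M'.Q (p' (Suc k)) (\<kappa> * x) = c'"
    using M'.casoratian[OF off(2), of k] by (simp add: c'_def)
  show ?thesis
    unfolding c_def[symmetric] c'_def[symmetric]
    using r1 r2 c c' unfolding row_def by algebra
qed

text \<open>The bound is written \<open>Suc d\<close> because off-diagonal entries lose one degree.
  In \<open>row_entries\<close> each factor is divided by its own order at infinity. In a diagonal
  entry one of the two products is smaller by x^(-2) and drops out; in an off-diagonal entry both
  have the same order, so both leading coefficients survive.\<close>

context
  fixes \<kappa> :: complex and Kp Km :: "complex poly" and d :: nat
  assumes \<kappa>: "\<kappa> \<noteq> 0" and dp: "degree Kp \<le> Suc d" and dm: "degree Km \<le> Suc d"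
begin

lemmas Kp_asymp = tendsto_poly_over_power[OF dp]
lemmas Km_asymp = tendsto_poly_over_power[OF dm]
lemmas p_asymp = M.p_asymp[OF one_neq_zero]
lemmas p'_asymp = M'.p_asymp[OF \<kappa>]
lemmas Q'_asymp = M'.Q_scaled_asymp[OF \<kappa>]
lemmas mult = tendsto_mult

lemma eventually_generic_nz: "\<forall>\<^sub>F x in at_infinity. x \<in> generic \<kappa> \<and> x \<noteq> 0"
  using eventually_generic[OF \<kappa>] by eventually_elim (auto simp: generic_def)

lemma upper_row_diag:
  assumes r: "\<forall>\<^sub>F x in at_infinity. row \<kappa> Kp Km (Suc k) M1 M2 x"
  shows "degree M1 \<le> Suc d" "coeff M1 (Suc d) = coeff Kp (Suc d) * \<kappa> ^ Suc k * M'.\<gamma> (Suc k) / M.\<gamma> (Suc k)"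
proof -
  let ?a = "M.\<gamma> k / M.\<gamma> (Suc k)"
  let ?f = "\<lambda>x. ?a * (poly Kp x / x ^ Suc d * (poly (p' (Suc k)) (\<kappa> * x) / x ^ Suc k) * (x ^ (k + 1) * M.Q (p k) x)
     - poly Km x / x ^ Suc d * (x ^ (Suc k + 1) * M'.Q (p' (Suc k)) (\<kappa> * x)) * (poly (p k) (1 * x) / x ^ k) * (1 / x)\<^sup>2)"
  have "(?f \<longlongrightarrow> ?a * (coeff Kp (Suc d) * (M'.\<gamma> (Suc k) * \<kappa> ^ Suc k) * (1 / M.\<gamma> k)
      - coeff Km (Suc d) * (1 / (M'.\<gamma> (Suc k) * \<kappa> ^ (Suc k + 1))) * (M.\<gamma> k * 1 ^ k) * 0\<^sup>2)) at_infinity"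
    by (rule tendsto_mult_left[OF tendsto_diff[OF
          mult[OF mult[OF Kp_asymp p'_asymp] M.Q_asymp]
          mult[OF mult[OF mult[OF Km_asymp Q'_asymp] p_asymp] inverse_square_tendsto_0]]])
  moreover have "\<forall>\<^sub>F x in at_infinity. ?f x = poly M1 x / x ^ Suc d"
    using r eventually_generic_nz
  proof eventually_elim
    case (elim x)
    then have x: "x \<noteq> 0" "x \<in> generic \<kappa>" by auto
    show ?case
      unfolding row_entries(1)[OF x(2) elim(1)] using x(1)
      by (simp add: divide_simps power2_eq_square)
  qed
  ultimately have "((\<lambda>x. poly M1 x / x ^ Suc d) \<longlongrightarrow>
      coeff Kp (Suc d) * \<kappa> ^ Suc k * M'.\<gamma> (Suc k) / M.\<gamma> (Suc k)) at_infinity"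
    by (rule Lim_transform_eventually[THEN tendsto_eq_rhs]) (use M.\<gamma>_nonzero in simp)
  from coeff_from_limit[OF this] show "degree M1 \<le> Suc d"
    "coeff M1 (Suc d) = coeff Kp (Suc d) * \<kappa> ^ Suc k * M'.\<gamma> (Suc k) / M.\<gamma> (Suc k)" .
qed

lemma upper_row_off_diag:
  assumes r: "\<forall>\<^sub>F x in at_infinity. row \<kappa> Kp Km (Suc k) M1 M2 x"
  shows "degree M2 \<le> d"
    "coeff M2 d = M.\<gamma> k / M.\<gamma> (Suc k) *
      (coeff Km (Suc d) * M.\<gamma> (Suc k) / (M'.\<gamma> (Suc k) * \<kappa> ^ (k + 2))
       - coeff Kp (Suc d) * \<kappa> ^ Suc k * M'.\<gamma> (Suc k) / M.\<gamma> (Suc k))"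
proof -
  let ?a = "M.\<gamma> k / M.\<gamma> (Suc k)"
  let ?f = "\<lambda>x. ?a * (poly Km x / x ^ Suc d * (x ^ (Suc k + 1) * M'.Q (p' (Suc k)) (\<kappa> * x)) * (poly (p (Suc k)) (1 * x) / x ^ Suc k)
     - poly Kp x / x ^ Suc d * (poly (p' (Suc k)) (\<kappa> * x) / x ^ Suc k) * (x ^ (Suc k + 1) * M.Q (p (Suc k)) x))"
  have "(?f \<longlongrightarrow> ?a * (coeff Km (Suc d) * (1 / (M'.\<gamma> (Suc k) * \<kappa> ^ (Suc k + 1))) * (M.\<gamma> (Suc k) * 1 ^ Suc k)
      - coeff Kp (Suc d) * (M'.\<gamma> (Suc k) * \<kappa> ^ Suc k) * (1 / M.\<gamma> (Suc k)))) at_infinity"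
    by (rule tendsto_mult_left[OF tendsto_diff[OF
          mult[OF mult[OF Km_asymp Q'_asymp] p_asymp]
          mult[OF mult[OF Kp_asymp p'_asymp] M.Q_asymp]]])
  moreover have "\<forall>\<^sub>F x in at_infinity. ?f x = poly M2 x / x ^ d"
    using r eventually_generic_nz
  proof eventually_elim
    case (elim x)
    then have x: "x \<noteq> 0" "x \<in> generic \<kappa>" by auto
    show ?case
      unfolding row_entries(2)[OF x(2) elim(1)] using x(1)
      by (simp add: divide_simps)
  qed
  ultimately have "((\<lambda>x. poly M2 x / x ^ d) \<longlongrightarrow> ?a *
      (coeff Km (Suc d) * M.\<gamma> (Suc k) / (M'.\<gamma> (Suc k) * \<kappa> ^ (k + 2))
       - coeff Kp (Suc d) * \<kappa> ^ Suc k * M'.\<gamma> (Suc k) / M.\<gamma> (Suc k))) at_infinity"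
    by (rule Lim_transform_eventually[THEN tendsto_eq_rhs]) (simp add: ac_simps)
  from coeff_from_limit[OF this] show "degree M2 \<le> d"
    "coeff M2 d = ?a *
      (coeff Km (Suc d) * M.\<gamma> (Suc k) / (M'.\<gamma> (Suc k) * \<kappa> ^ (k + 2))
       - coeff Kp (Suc d) * \<kappa> ^ Suc k * M'.\<gamma> (Suc k) / M.\<gamma> (Suc k))" .
qed

lemma lower_row_off_diag:
  assumes r: "\<forall>\<^sub>F x in at_infinity. row \<kappa> Kp Km k M1 M2 x"
  shows "degree M1 \<le> d"
    "coeff M1 d = M.\<gamma> k / M.\<gamma> (Suc k) *
      (coeff Kp (Suc d) * \<kappa> ^ k * M'.\<gamma> k / M.\<gamma> k
       - coeff Km (Suc d) * M.\<gamma> k / (M'.\<gamma> k * \<kappa> ^ Suc k))"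
proof -
  let ?a = "M.\<gamma> k / M.\<gamma> (Suc k)"
  let ?f = "\<lambda>x. ?a * (poly Kp x / x ^ Suc d * (poly (p' k) (\<kappa> * x) / x ^ k) * (x ^ (k + 1) * M.Q (p k) x)
     - poly Km x / x ^ Suc d * (x ^ (k + 1) * M'.Q (p' k) (\<kappa> * x)) * (poly (p k) (1 * x) / x ^ k))"
  have "(?f \<longlongrightarrow> ?a * (coeff Kp (Suc d) * (M'.\<gamma> k * \<kappa> ^ k) * (1 / M.\<gamma> k)
      - coeff Km (Suc d) * (1 / (M'.\<gamma> k * \<kappa> ^ (k + 1))) * (M.\<gamma> k * 1 ^ k))) at_infinity"
    by (rule tendsto_mult_left[OF tendsto_diff[OF
          mult[OF mult[OF Kp_asymp p'_asymp] M.Q_asymp]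
          mult[OF mult[OF Km_asymp Q'_asymp] p_asymp]]])
  moreover have "\<forall>\<^sub>F x in at_infinity. ?f x = poly M1 x / x ^ d"
    using r eventually_generic_nz
  proof eventually_elim
    case (elim x)
    then have x: "x \<noteq> 0" "x \<in> generic \<kappa>" by auto
    show ?case
      unfolding row_entries(1)[OF x(2) elim(1)] using x(1)
      by (simp add: divide_simps)
  qed
  ultimately have "((\<lambda>x. poly M1 x / x ^ d) \<longlongrightarrow> ?a *
      (coeff Kp (Suc d) * \<kappa> ^ k * M'.\<gamma> k / M.\<gamma> k
       - coeff Km (Suc d) * M.\<gamma> k / (M'.\<gamma> k * \<kappa> ^ Suc k))) at_infinity"
    by (rule Lim_transform_eventually[THEN tendsto_eq_rhs]) (simp add: ac_simps)
  from coeff_from_limit[OF this] show "degree M1 \<le> d"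
    "coeff M1 d = ?a *
      (coeff Kp (Suc d) * \<kappa> ^ k * M'.\<gamma> k / M.\<gamma> k
       - coeff Km (Suc d) * M.\<gamma> k / (M'.\<gamma> k * \<kappa> ^ Suc k))" .
qed

lemma lower_row_diag:
  assumes r: "\<forall>\<^sub>F x in at_infinity. row \<kappa> Kp Km k M1 M2 x"
  shows "degree M2 \<le> Suc d" "coeff M2 (Suc d) = coeff Km (Suc d) * M.\<gamma> k / (M'.\<gamma> k * \<kappa> ^ Suc k)"
proof -
  let ?a = "M.\<gamma> k / M.\<gamma> (Suc k)"
  let ?f = "\<lambda>x. ?a * (poly Km x / x ^ Suc d * (x ^ (k + 1) * M'.Q (p' k) (\<kappa> * x)) * (poly (p (Suc k)) (1 * x) / x ^ Suc k)
     - poly Kp x / x ^ Suc d * (poly (p' k) (\<kappa> * x) / x ^ k) * (x ^ (Suc k + 1) * M.Q (p (Suc k)) x) * (1 / x)\<^sup>2)"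
  have "(?f \<longlongrightarrow> ?a * (coeff Km (Suc d) * (1 / (M'.\<gamma> k * \<kappa> ^ (k + 1))) * (M.\<gamma> (Suc k) * 1 ^ Suc k)
      - coeff Kp (Suc d) * (M'.\<gamma> k * \<kappa> ^ k) * (1 / M.\<gamma> (Suc k)) * 0\<^sup>2)) at_infinity"
    by (rule tendsto_mult_left[OF tendsto_diff[OF
          mult[OF mult[OF Km_asymp Q'_asymp] p_asymp]
          mult[OF mult[OF mult[OF Kp_asymp p'_asymp] M.Q_asymp] inverse_square_tendsto_0]]])
  moreover have "\<forall>\<^sub>F x in at_infinity. ?f x = poly M2 x / x ^ Suc d"
    using r eventually_generic_nz
  proof eventually_elim
    case (elim x)
    then have x: "x \<noteq> 0" "x \<in> generic \<kappa>" by auto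
    show ?case
      unfolding row_entries(2)[OF x(2) elim(1)] using x(1)
      by (simp add: divide_simps power2_eq_square)
  qed
  ultimately have "((\<lambda>x. poly M2 x / x ^ Suc d) \<longlongrightarrow>
      coeff Km (Suc d) * M.\<gamma> k / (M'.\<gamma> k * \<kappa> ^ Suc k)) at_infinity"
    by (rule Lim_transform_eventually[THEN tendsto_eq_rhs]) (use M.\<gamma>_nonzero in simp)
  from coeff_from_limit[OF this] show "degree M2 \<le> Suc d"
    "coeff M2 (Suc d) = coeff Km (Suc d) * M.\<gamma> k / (M'.\<gamma> k * \<kappa> ^ Suc k)" .
qed

end

end

context orthonormal_polys
begin

lemma self_pair: "orthonormal_pair L S p L S p"
  by (simp add: orthonormal_pair_def orthonormal_polys_axioms)

text \<open>The origin is never generic, so the explicit polynomials are evaluated instead of the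
  row identity. At x = 0 the shift by \<kappa> is invisible and N vanishes, so Cramer's rule returns
  the identity matrix times Kp(0).\<close>

lemma self_row_at_0:
  assumes "poly Km 0 = poly Kp 0" "poly N 0 = 0"
  shows "poly (orthonormal_pair.row_poly1 L S p L S p k \<kappa> Kp Km N (Suc k)) 0 = poly Kp 0"
    and "poly (orthonormal_pair.row_poly2 L S p L S p k \<kappa> Kp Km N (Suc k)) 0 = 0"
    and "poly (orthonormal_pair.row_poly1 L S p L S p k \<kappa> Kp Km N k) 0 = 0"
    and "poly (orthonormal_pair.row_poly2 L S p L S p k \<kappa> Kp Km N k) 0 = poly Kp 0"
proof -
  define c where "c = \<gamma> k / \<gamma> (Suc k)"
  have c: "c * (poly (p k) 0 * poly (assoc_poly (p (Suc k))) 0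
      - poly (p (Suc k)) 0 * poly (assoc_poly (p k)) 0) = 1"
    using arg_cong[OF casoratian_poly[of k], of "\<lambda>P. poly P 0"] \<gamma>_nonzero
    by (simp add: c_def)
  show "poly (orthonormal_pair.row_poly1 L S p L S p k \<kappa> Kp Km N (Suc k)) 0 = poly Kp 0"
    "poly (orthonormal_pair.row_poly2 L S p L S p k \<kappa> Kp Km N (Suc k)) 0 = 0"
    "poly (orthonormal_pair.row_poly1 L S p L S p k \<kappa> Kp Km N k) 0 = 0"
    "poly (orthonormal_pair.row_poly2 L S p L S p k \<kappa> Kp Km N k) 0 = poly Kp 0"
    unfolding orthonormal_pair.row_poly1_def[OF self_pair] orthonormal_pair.row_poly2_def[OF self_pair]
      c_def[symmetric] poly_smult poly_add poly_diff poly_mult poly_minus poly_pcompose assms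
    using c by (simp_all, algebra+)
qed

end

section \<open>The weight and the Jackson integral\<close>

lemma convergent_prod_qpoch:
  assumes "norm q < 1"
  shows "convergent_prod (\<lambda>j. 1 - a * q ^ j :: complex)"
proof -
  have "summable (\<lambda>j. norm (a * q ^ j))"
    using assms by (simp add: norm_mult norm_power summable_mult summable_geometric)
  then have "summable (\<lambda>j. norm (1 - a * q ^ j - 1))" by simp
  then show ?thesis
    by (intro abs_convergent_prod_imp_convergent_prod summable_imp_abs_convergent_prod)
qed

lemma qpoch_inf_rec:
  assumes "norm q < 1"
  shows "qpoch_inf a q = (1 - a) * qpoch_inf (a * q) q"
proof -
  have "qpoch_inf a q = (\<Prod>j<1. 1 - a * q ^ j) * (\<Prod>j. 1 - a * q ^ (j + 1))"
    unfolding qpoch_inf_def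
    by (rule has_prod_unique[OF has_prod_ignore_initial_segment'[OF convergent_prod_qpoch[OF assms]], symmetric])
  then show ?thesis by (simp add: qpoch_inf_def mult.assoc)
qed

lemma countable_qpoch_zeros:
  assumes "q \<noteq> 0" "norm q < 1"
  shows "countable {x. qpoch_inf (c * x) q = 0}"
proof -
  have "{x. qpoch_inf (c * x) q = 0} \<subseteq> range (\<lambda>j::nat. 1 / (c * q ^ j))"
  proof
    fix x assume "x \<in> {x. qpoch_inf (c * x) q = 0}"
    then obtain j :: nat where "1 - c * x * q ^ j = 0"
      using prodinf_nonzero[OF convergent_prod_qpoch[OF assms(2), of "c * x"]]
      unfolding qpoch_inf_def by blast
    then have e: "x * (c * q ^ j) = 1" by (simp add: mult_ac)
    then have "c * q ^ j \<noteq> 0" by (metis mult_zero_right zero_neq_one)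
    with e have "x = 1 / (c * q ^ j)" by (simp only: eq_divide_eq if_True refl if_False not_False_eq_True)
    then show "x \<in> range (\<lambda>j::nat. 1 / (c * q ^ j))" by blast
  qed
  then show ?thesis by (rule countable_subset) simp
qed

lemma weight_num_rec:
  assumes "norm q < 1"
  shows "weight_num q b t x =
    (1 - b 2 * x) * (1 - b 3 * x) * (1 - x / (b 6 * t)) * weight_num q b t (q * x)"
  unfolding weight_num_def qpoch_inf_rec[OF assms, of "b 2 * x"] qpoch_inf_rec[OF assms, of "b 3 * x"]
    qpoch_inf_rec[OF assms, of "x / (b 6 * t)"]
  by (simp add: mult_ac)

lemma weight_den_rec:
  assumes "norm q < 1"
  shows "weight_den q b t x =
    (1 - b 1 * x) * (1 - b 4 * x) * (1 - b 6 * x / t) * weight_den q b t (q * x)"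
  unfolding weight_den_def qpoch_inf_rec[OF assms, of "b 1 * x"] qpoch_inf_rec[OF assms, of "b 4 * x"]
    qpoch_inf_rec[OF assms, of "b 6 * x / t"]
  by (simp add: mult_ac)

lemma weight_num_shift:
  assumes "norm q < 1" "q \<noteq> 0"
  shows "weight_num q b (q * t) x = (1 - x / (b 6 * (q * t))) * weight_num q b t x"
proof -
  have "x / (b 6 * (q * t)) * q = x / (b 6 * t)" using assms(2) by simp
  then show ?thesis
    unfolding weight_num_def qpoch_inf_rec[OF assms(1), of "x / (b 6 * (q * t))"] by simp
qed

lemma weight_den_shift:
  assumes "norm q < 1" "q \<noteq> 0"
  shows "weight_den q b (q * t) x = (1 - b 6 * x / (q * t)) * weight_den q b t x"
proof -
  have "b 6 * x / (q * t) * q = b 6 * x / t" using assms(2) by simp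
  then show ?thesis
    unfolding weight_den_def qpoch_inf_rec[OF assms(1), of "b 6 * x / (q * t)"] by simp
qed

lemma weight_spectral_ratio:
  assumes "norm q < 1" "b 6 \<noteq> 0" "t \<noteq> 0" "weight_den q b t x \<noteq> 0"
  shows "weight q b t (q * x) * D_minus b t x = D_plus b t x * weight q b t x"
proof -
  have d: "D_minus b t x = (1 - b 2 * x) * (1 - b 3 * x) * (1 - x / (b 6 * t)) * (b 6 * t)"
    "D_plus b t x = (1 - b 1 * x) * (1 - b 4 * x) * (1 - b 6 * x / t) * (b 6 * t)"
    using assms(2,3) by (simp_all add: D_minus_def D_plus_def field_simps)
  note r = weight_num_rec[OF assms(1), of b t x] weight_den_rec[OF assms(1), of b t x]
  \<comment> \<open>By the recursion the denominator at \<open>q * x\<close> is a factor of the one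
    at \<open>x\<close>.\<close>
  have nz: "weight_den q b t (q * x) \<noteq> 0"
    "(1 - b 1 * x) * (1 - b 4 * x) * (1 - b 6 * x / t) \<noteq> 0"
    using assms(4) unfolding r by auto
  define n1 d1 where "n1 = (1 - b 2 * x) * (1 - b 3 * x) * (1 - x / (b 6 * t))"
    and "d1 = (1 - b 1 * x) * (1 - b 4 * x) * (1 - b 6 * x / t)"
  have "d1 \<noteq> 0" using nz(2) by (simp add: d1_def)
  show ?thesis
    unfolding weight_def d r n1_def[symmetric] d1_def[symmetric]
    using nz(1) \<open>d1 \<noteq> 0\<close> by (simp add: divide_simps)
qed

lemma weight_deformation_ratio:
  assumes "norm q < 1" "q \<noteq> 0" "b 6 \<noteq> 0" "t \<noteq> 0" "weight_den q b (q * t) x \<noteq> 0"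
  shows "weight q b (q * t) x * E_minus q b t x = E_plus q b t x * weight q b t x"
proof -
  have e: "E_minus q b t x = (1 - b 6 * x / (q * t)) * (q * t)"
    "E_plus q b t x = (1 - x / (b 6 * (q * t))) * (q * t)"
    using assms(2-4) by (simp_all add: E_minus_def E_plus_def field_simps)
  note r = weight_num_shift[OF assms(1,2), of b t x] weight_den_shift[OF assms(1,2), of b t x]
  have nz: "weight_den q b t x \<noteq> 0" "1 - b 6 * x / (q * t) \<noteq> 0"
    using assms(5) unfolding r by auto
  define n1 d1 where "n1 = 1 - x / (b 6 * (q * t))" and "d1 = 1 - b 6 * x / (q * t)"
  have "d1 \<noteq> 0" using nz(2) by (simp add: d1_def)
  show ?thesis
    unfolding weight_def e r n1_def[symmetric] d1_def[symmetric]
    using nz(1) \<open>d1 \<noteq> 0\<close> by (simp add: divide_simps)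
qed

text \<open>Ratio test: consecutive terms have the ratio q D_+ / D_-, which tends to q along the
  lattice because D_+ and D_- both equal b6 t at the origin.\<close>

lemma summable_weight:
  assumes q: "q \<noteq> 0" "norm q < 1" and nz: "b 6 \<noteq> 0" "t \<noteq> 0"
    and den: "\<And>k. weight_den q b t (e * q ^ k) \<noteq> 0"
  shows "summable (\<lambda>k. norm (q ^ k * weight q b t (e * q ^ k)))"
proof -
  \<comment> \<open>Any number strictly between |q| and 1 serves as the ratio.\<close>
  define c where "c = (norm q + 1) / 2"
  have c: "norm q < c" "c < 1" using q by (simp_all add: c_def)
  have e: "(\<lambda>k. e * q ^ k) \<longlonglongrightarrow> e * 0"
    by (intro tendsto_mult tendsto_const LIMSEQ_power_zero q)
  have cont: "isCont (\<lambda>y. norm (q * (D_plus b t y / D_minus b t y))) (e * 0)"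
    unfolding D_plus_def D_minus_def using nz by (intro continuous_intros) simp
  have lim: "(\<lambda>k. norm (q * (D_plus b t (e * q ^ k) / D_minus b t (e * q ^ k)))) \<longlonglongrightarrow> norm q"
    by (rule tendsto_eq_rhs[OF isCont_tendsto_compose[OF cont e]])
      (use nz in \<open>simp add: D_plus_def D_minus_def\<close>)
  have "\<forall>\<^sub>F k in sequentially. norm (q * (D_plus b t (e * q ^ k) / D_minus b t (e * q ^ k))) < c"
    using order_tendstoD(2)[OF lim c(1)] .
  moreover have "\<forall>\<^sub>F k in sequentially. D_minus b t (e * q ^ k) \<noteq> 0"
  proof -
    have "isCont (D_minus b t) (e * 0)"
      unfolding D_minus_def by (intro continuous_intros)
    from isCont_tendsto_compose[OF this e]
    have "(\<lambda>k. D_minus b t (e * q ^ k)) \<longlonglongrightarrow> D_minus b t (e * 0)" .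
    moreover have "D_minus b t (e * 0) \<noteq> 0" using nz by (simp add: D_minus_def)
    ultimately show ?thesis by (rule tendsto_imp_eventually_ne)
  qed
  ultimately have "\<forall>\<^sub>F k in sequentially.
    norm (q ^ Suc k * weight q b t (e * q ^ Suc k)) \<le> c * norm (q ^ k * weight q b t (e * q ^ k))"
  proof eventually_elim
    case (elim k)
    define y where "y = e * q ^ k"
    have "weight q b t (q * y) = D_plus b t y * weight q b t y / D_minus b t y"
      using weight_spectral_ratio[OF q(2) nz den[of k]] elim(2)
      unfolding y_def[symmetric] by (simp add: field_simps)
    then have "q ^ Suc k * weight q b t (e * q ^ Suc k)
        = (q * (D_plus b t y / D_minus b t y)) * (q ^ k * weight q b t y)"
      by (simp add: y_def mult_ac)
    then show ?case
      using elim(1) unfolding y_def[symmetric] by (simp only: norm_mult[of "q * _"]) (intro mult_right_mono, simp_all)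
  qed
  then obtain N where "\<And>k. k \<ge> N \<Longrightarrow>
    norm (q ^ Suc k * weight q b t (e * q ^ Suc k)) \<le> c * norm (q ^ k * weight q b t (e * q ^ k))"
    by (auto simp: eventually_sequentially)
  then show ?thesis by (intro summable_ratio_test[OF c(2), of N]) (simp only: real_norm_def abs_norm_cancel)
qed

text \<open>The series of the norms of the weights dominates: a function bounded by K on
  \<open>S\<close> yields a series bounded by K times its sum.\<close>

lemma jackson0_weighted:
  assumes s: "summable (\<lambda>k. norm (q ^ k * w (e * q ^ k)))"
    and sub: "range (\<lambda>k::nat. e * q ^ k) \<subseteq> S"
  shows "bounded (h1 ` S) \<Longrightarrow> bounded (h2 ` S) \<Longrightarrow>
      jackson0 q e (\<lambda>y. w y * (c * h1 y + h2 y)) =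
      c * jackson0 q e (\<lambda>y. w y * h1 y) + jackson0 q e (\<lambda>y. w y * h2 y)"
    and "\<exists>M. \<forall>h K. (\<forall>y\<in>S. norm (h y) \<le> K) \<longrightarrow> norm (jackson0 q e (\<lambda>y. w y * h y)) \<le> M * K"
proof -
  define u where "u k = q ^ k * w (e * q ^ k)" for k
  have in_S: "e * q ^ k \<in> S" for k using sub by auto
  have norm_summable: "summable (\<lambda>k. norm (u k * h (e * q ^ k)))"
    and le: "(\<Sum>k. norm (u k * h (e * q ^ k))) \<le> suminf (\<lambda>k. norm (u k)) * K"
    if "\<forall>y\<in>S. norm (h y) \<le> K" for h K
  proof -
    have b: "norm (u k * h (e * q ^ k)) \<le> norm (u k) * K" for k
      unfolding norm_mult using that in_S by (intro mult_left_mono) auto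
    have s': "summable (\<lambda>k. norm (u k) * K)" using s unfolding u_def by (rule summable_mult2)
    show 1: "summable (\<lambda>k. norm (u k * h (e * q ^ k)))"
      by (rule summable_comparison_test'[OF s', of 0]) (use b in simp)
    show "(\<Sum>k. norm (u k * h (e * q ^ k))) \<le> suminf (\<lambda>k. norm (u k)) * K"
      using suminf_le[OF b 1 s'] s unfolding u_def by (simp add: suminf_mult2)
  qed
  have j: "jackson0 q e (\<lambda>y. w y * h y) = (1 - q) * e * (\<Sum>k. u k * h (e * q ^ k))" for h
    by (simp add: jackson0_def u_def mult.assoc)
  show "jackson0 q e (\<lambda>y. w y * (c * h1 y + h2 y)) =
      c * jackson0 q e (\<lambda>y. w y * h1 y) + jackson0 q e (\<lambda>y. w y * h2 y)"
    if b: "bounded (h1 ` S)" "bounded (h2 ` S)"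
  proof -
    obtain K1 where "\<forall>y\<in>S. norm (h1 y) \<le> K1" using b(1) by (auto simp: bounded_iff)
    moreover obtain K2 where "\<forall>y\<in>S. norm (h2 y) \<le> K2" using b(2) by (auto simp: bounded_iff)
    ultimately have s1: "summable (\<lambda>k. u k * h1 (e * q ^ k))" and s2: "summable (\<lambda>k. u k * h2 (e * q ^ k))"
      by (blast intro: summable_norm_cancel[OF norm_summable])+
    have "(\<Sum>k. u k * (c * h1 (e * q ^ k) + h2 (e * q ^ k)))
        = (\<Sum>k. c * (u k * h1 (e * q ^ k)) + u k * h2 (e * q ^ k))"
      by (simp add: algebra_simps)
    also have "\<dots> = c * (\<Sum>k. u k * h1 (e * q ^ k)) + (\<Sum>k. u k * h2 (e * q ^ k))"
      using s1 s2 by (simp add: suminf_add[symmetric] suminf_mult summable_mult)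
    finally show ?thesis unfolding j[of "\<lambda>y. c * h1 y + h2 y"] j by (simp add: algebra_simps)
  qed
  have "norm (jackson0 q e (\<lambda>y. w y * h y)) \<le> (norm ((1 - q) * e) * suminf (\<lambda>k. norm (u k))) * K"
    if "\<forall>y\<in>S. norm (h y) \<le> K" for h K
  proof -
    have "norm (\<Sum>k. u k * h (e * q ^ k)) \<le> suminf (\<lambda>k. norm (u k)) * K"
      using summable_norm[OF norm_summable[OF that]] le[OF that] by linarith
    then have "norm ((1 - q) * e) * norm (\<Sum>k. u k * h (e * q ^ k))
        \<le> norm ((1 - q) * e) * (suminf (\<lambda>k. norm (u k)) * K)"
      by (rule mult_left_mono) simp
    then show ?thesis unfolding j norm_mult[of "(1 - q) * e"] by (simp only: mult.assoc)
  qed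
  then show "\<exists>M. \<forall>h K. (\<forall>y\<in>S. norm (h y) \<le> K) \<longrightarrow> norm (jackson0 q e (\<lambda>y. w y * h y)) \<le> M * K"
    by blast
qed

lemma jackson_support_closed:
  assumes "norm q < 1"
  shows "bounded (jackson_support q a c)" "closed (insert 0 (jackson_support q a c))"
proof -
  have "(\<lambda>k. e * q ^ k) \<longlonglongrightarrow> e * 0" for e
    by (intro tendsto_mult tendsto_const LIMSEQ_power_zero assms)
  then have "compact (insert 0 (range (\<lambda>k. e * q ^ k)))" for e
    by (intro compact_sequence_with_limit) simp
  then have "compact (insert 0 (range (\<lambda>k. a * q ^ k)) \<union> insert 0 (range (\<lambda>k. c * q ^ k)))"
    by (intro compact_Un)
  then have c: "compact (insert 0 (jackson_support q a c))"
    by (simp add: jackson_support_def)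
  then show "closed (insert 0 (jackson_support q a c))" by (rule compact_imp_closed)
  show "bounded (jackson_support q a c)"
    using compact_imp_bounded[OF c] by (rule bounded_subset) auto
qed

definition weighted_jackson ::
  "complex \<Rightarrow> (nat \<Rightarrow> complex) \<Rightarrow> complex \<Rightarrow> complex \<Rightarrow> complex \<Rightarrow> (complex \<Rightarrow> complex) \<Rightarrow> complex" where
  "weighted_jackson q b a c t h = jackson q a c (\<lambda>y. weight q b t y * h y)"

lemma moment_functional_weighted_jackson:
  assumes q: "q \<noteq> 0" "norm q < 1" and nz: "b 6 \<noteq> 0" "t \<noteq> 0"
    and adm: "admissible_terminals q b a c t"
  shows "moment_functional (weighted_jackson q b a c t) (jackson_support q a c)"
proof
  let ?S = "jackson_support q a c" and ?w = "weight q b t"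
  have den: "weight_den q b t (a * q ^ k) \<noteq> 0" "weight_den q b t (c * q ^ k) \<noteq> 0" for k
    using adm by (auto simp: admissible_terminals_def jackson_support_def)
  have sub: "range (\<lambda>k::nat. a * q ^ k) \<subseteq> ?S" "range (\<lambda>k::nat. c * q ^ k) \<subseteq> ?S"
    by (auto simp: jackson_support_def)
  note Ja = jackson0_weighted[where w="?w" and S="?S", OF summable_weight[OF q nz den(1)] sub(1)]
  note Jc = jackson0_weighted[where w="?w" and S="?S", OF summable_weight[OF q nz den(2)] sub(2)]
  show "weighted_jackson q b a c t (\<lambda>y. k * h1 y + h2 y)
      = k * weighted_jackson q b a c t h1 + weighted_jackson q b a c t h2"
    if "bounded (h1 ` ?S)" "bounded (h2 ` ?S)" for h1 h2 k
    unfolding weighted_jackson_def jackson_def Ja(1)[OF that] Jc(1)[OF that]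
    by (simp add: algebra_simps)
  obtain Ma where Ma: "\<And>h K. (\<forall>y\<in>?S. norm (h y) \<le> K) \<Longrightarrow>
      norm (jackson0 q a (\<lambda>y. ?w y * h y)) \<le> Ma * K" using Ja(2) by blast
  obtain Mc where Mc: "\<And>h K. (\<forall>y\<in>?S. norm (h y) \<le> K) \<Longrightarrow>
      norm (jackson0 q c (\<lambda>y. ?w y * h y)) \<le> Mc * K" using Jc(2) by blast
  have "norm (weighted_jackson q b a c t h) \<le> (Mc + Ma) * K" if "\<forall>y\<in>?S. norm (h y) \<le> K" for h K
    unfolding weighted_jackson_def jackson_def distrib_right
    using Ma[OF that] Mc[OF that] by (intro norm_triangle_le_diff) simp
  then show "\<exists>M. \<forall>h K. (\<forall>y\<in>?S. norm (h y) \<le> K) \<longrightarrow> norm (weighted_jackson q b a c t h) \<le> M * K"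
    by blast
qed (use jackson_support_closed[OF q(2)] in auto)

lemma orthonormal_polys_weighted_jackson:
  assumes "q \<noteq> 0" "norm q < 1" "b 6 \<noteq> 0" "t \<noteq> 0" "admissible_terminals q b a c t"
    and o: "orthonormal_system q b a c t p"
  shows "orthonormal_polys (weighted_jackson q b a c t) (jackson_support q a c) p"
proof -
  interpret moment_functional "weighted_jackson q b a c t" "jackson_support q a c"
    by (rule moment_functional_weighted_jackson[OF assms(1-5)])
  show ?thesis
    by unfold_locales (use o in \<open>auto simp: orthonormal_system_def weighted_jackson_def mult.assoc\<close>)
qed

section \<open>Structure polynomials and exceptional sets\<close>

text \<open>\<open>P14\<close> over \<open>P23\<close> is the quotient w(q x; q t) / w(x; t), in
  which the products in x / t cancel.\<close>

definition P14 :: "(nat \<Rightarrow> complex) \<Rightarrow> complex poly" where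
  "P14 b = [:1, - b 1:] * [:1, - b 4:]"

definition P23 :: "(nat \<Rightarrow> complex) \<Rightarrow> complex poly" where
  "P23 b = [:1, - b 2:] * [:1, - b 3:]"

definition Dp :: "(nat \<Rightarrow> complex) \<Rightarrow> complex \<Rightarrow> complex poly" where
  "Dp b t = smult (b 6) (P14 b * [:t, - b 6:])"

definition Dm :: "(nat \<Rightarrow> complex) \<Rightarrow> complex \<Rightarrow> complex poly" where
  "Dm b t = P23 b * [:b 6 * t, - 1:]"

lemma poly_D [simp]: "poly (Dp b t) x = D_plus b t x" "poly (Dm b t) x = D_minus b t x"
  by (simp_all add: Dp_def Dm_def P14_def P23_def D_plus_def D_minus_def algebra_simps)

lemma P14_P23_coeffs:
  "degree (P14 b) \<le> 2" "degree (P23 b) \<le> 2" "coeff (P14 b) 2 = b 1 * b 4" "coeff (P23 b) 2 = b 2 * b 3"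
  by (simp_all add: P14_def P23_def numeral_2_eq_2)

lemma D_coeffs:
  "degree (Dp b t) \<le> 3" "degree (Dm b t) \<le> 3"
  "coeff (Dp b t) 3 = - b 1 * b 4 * (b 6)\<^sup>2" "coeff (Dm b t) 3 = - b 2 * b 3"
  by (simp_all add: Dp_def Dm_def P14_def P23_def numeral_3_eq_3 power2_eq_square)

text \<open>Zeros and poles of the weight and the points of summation form countably many geometric
  sequences. Hence an identity at regular points is an identity at infinitely many points.\<close>

lemma countable_irregular:
  assumes "q \<noteq> 0" "norm q < 1"
  shows "countable {x. \<not> regular_point q b a c t x}"
proof -
  have 1: "countable {x. qpoch_inf (c * x) q = 0}" for c
    by (rule countable_qpoch_zeros[OF assms])
  have eq: "x / (b 6 * t) = inverse (b 6 * t) * x" "b 6 * x / t = (b 6 * inverse t) * x" for x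
    by (simp_all add: divide_inverse)
  have "countable {x. weight_num q b t x = 0}" "countable {x. weight_den q b t x = 0}"
    unfolding weight_num_def weight_den_def mult_eq_0_iff Collect_disj_eq eq
    by (intro countable_Un 1)+
  moreover have "countable (jackson_support q a c)"
    unfolding jackson_support_def by simp
  ultimately have "countable (insert 0 ({x. weight_num q b t x = 0} \<union> {x. weight_den q b t x = 0}
      \<union> jackson_support q a c))" by simp
  then show ?thesis by (rule countable_subset[rotated]) (auto simp: regular_point_def)
qed

lemma countable_scaled_vimage:
  fixes \<kappa> :: complex
  assumes "\<kappa> \<noteq> 0" "countable C"
  shows "countable {x. \<kappa> * x \<in> C}"
proof -
  have "{x. \<kappa> * x \<in> C} \<subseteq> (\<lambda>y. y / \<kappa>) ` C"
  proof
    fix x assume "x \<in> {x. \<kappa> * x \<in> C}"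
    then show "x \<in> (\<lambda>y. y / \<kappa>) ` C" using assms(1) by (intro image_eqI[of _ _ "\<kappa> * x"]) auto
  qed
  then show ?thesis using assms(2) by (meson countable_image countable_subset)
qed

lemma infinite_Compl_countable: "countable C \<Longrightarrow> infinite (- C :: complex set)"
proof
  assume "countable C" "finite (- C)"
  then have "countable (C \<union> - C)" by (meson countable_Un countable_finite)
  then show False using uncountable_UNIV_complex by (simp only: Compl_partition)
qed

text \<open>Points outside a countable set come arbitrarily close to z, and continuity carries the
  bound to z. This takes the place of a removable singularity for the quotient N / M.\<close>

lemma poly_bound_off_countable:
  fixes N :: "complex poly"
  assumes C: "countable C" and e: "e > 0" and root: "poly M z = 0"
    and b: "\<And>x. x \<in> ball z e - C \<Longrightarrow> norm (poly N x) \<le> K * norm (poly M x)"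
  shows "poly N z = 0"
proof -
  have near: "\<exists>x. norm (x - z) < d \<and> x \<in> ball z e - C" if "d > 0" for d
  proof -
    have "uncountable (ball z (min d e))" using that e by (intro uncountable_ball) simp
    then obtain x where "x \<in> ball z (min d e)" "x \<notin> C"
      using C by (meson countable_subset subsetI)
    then show ?thesis by (auto simp: dist_norm norm_minus_commute)
  qed
  define X where "X i = (SOME x. norm (x - z) < 1 / Suc i \<and> x \<in> ball z e - C)" for i :: nat
  have X: "norm (X i - z) < 1 / Suc i" "X i \<in> ball z e - C" for i
    using someI_ex[OF near[of "1 / Suc i"]] unfolding X_def by simp_all
  have "(\<lambda>i. X i - z) \<longlonglongrightarrow> 0"
    by (rule Lim_null_comparison[OF _ LIMSEQ_Suc[OF lim_inverse_n']])
      (use X(1) in \<open>auto intro!: always_eventually less_imp_le\<close>)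
  then have lim: "X \<longlonglongrightarrow> z" by (simp add: LIM_zero_iff)
  have "(\<lambda>i. norm (poly N (X i))) \<longlonglongrightarrow> norm (poly N z)"
    by (intro tendsto_norm isCont_tendsto_compose[OF _ lim]) simp
  moreover have "(\<lambda>i. K * norm (poly M (X i))) \<longlonglongrightarrow> K * norm (poly M z)"
    by (intro tendsto_mult tendsto_const tendsto_norm isCont_tendsto_compose[OF _ lim]) simp
  ultimately have "norm (poly N z) \<le> K * norm (poly M z)"
    by (rule LIMSEQ_le) (use b X(2) in blast)
  then show ?thesis using root by simp
qed

lemma mat22_nth [simp]:
  "mat22 m11 m12 m21 m22 $ 1 $ 1 = m11" "mat22 m11 m12 m21 m22 $ 1 $ 2 = m12"
  "mat22 m11 m12 m21 m22 $ 2 $ 1 = m21" "mat22 m11 m12 m21 m22 $ 2 $ 2 = m22"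
  by (simp_all add: mat22_def vector_2)

lemma mat22_eqD:
  assumes "scale_mat s (mat22 y11 y12 y21 y22) = eval_mat (mat22 m11 m12 m21 m22) x ** mat22 z11 z12 z21 z22"
  shows "s * y11 = poly m11 x * z11 + poly m12 x * z21" "s * y12 = poly m11 x * z12 + poly m12 x * z22"
    "s * y21 = poly m21 x * z11 + poly m22 x * z21" "s * y22 = poly m21 x * z12 + poly m22 x * z22"
  using arg_cong[OF assms, of "\<lambda>M. M $ 1 $ 1"] arg_cong[OF assms, of "\<lambda>M. M $ 1 $ 2"]
    arg_cong[OF assms, of "\<lambda>M. M $ 2 $ 1"] arg_cong[OF assms, of "\<lambda>M. M $ 2 $ 2"]
  by (simp_all add: scale_mat_def eval_mat_def matrix_matrix_mult_def sum_2)

section \<open>The spectral matrix of one weight\<close>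

locale weight_system =
  fixes q :: complex and b :: "nat \<Rightarrow> complex" and a c t :: complex
    and p :: "nat \<Rightarrow> complex poly" and k :: nat
  assumes q_nz: "q \<noteq> 0" and q_lt: "norm q < 1" and b6_nz: "b 6 \<noteq> 0" and t_nz: "t \<noteq> 0"
    and admissible: "admissible_terminals q b a c t"
    and spectral_eq: "stieltjes_spectral_eq q b a c t"
    and system: "orthonormal_system q b a c t p"

sublocale weight_system \<subseteq> orthonormal_polys "weighted_jackson q b a c t" "jackson_support q a c" p
  by (rule orthonormal_polys_weighted_jackson[OF q_nz q_lt b6_nz t_nz admissible system])

sublocale weight_system \<subseteq> self: orthonormal_pair "weighted_jackson q b a c t" "jackson_support q a c" p
    "weighted_jackson q b a c t" "jackson_support q a c" p k
  by (rule self_pair)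

context weight_system
begin

lemma stieltjes_eq: "stieltjes q b a c t = \<phi>"
  by (simp add: fun_eq_iff stieltjes_def \<phi>_def Q_def weighted_jackson_def)

lemma second_kind_eq: "second_kind q b a c t P = Q P"
  by (simp add: fun_eq_iff second_kind_def Q_def weighted_jackson_def)

lemma spectral_poly:
  shows "\<exists>U. \<forall>x\<in>self.generic q.
    D_minus b t x * \<phi> (q * x) = D_plus b t x * \<phi> x + (q - 1) * x * poly U x"
proof -
  obtain U where "\<forall>x. x \<noteq> 0 \<and> x \<notin> jackson_support q a c \<and> q * x \<notin> jackson_support q a c \<longrightarrow>
      D_minus b t x * \<phi> (q * x) = D_plus b t x * \<phi> x + (q - 1) * x * poly U x"
    using spectral_eq unfolding stieltjes_spectral_eq_def stieltjes_eq by blast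
  then show ?thesis by (intro exI[of _ U]) (simp add: self.generic_def)
qed

text \<open>At regular points the weight can be multiplied out, which turns the matrix identity into
  row identities. The explicit solution satisfies these at all generic points, and uniqueness hands
  this, together with the values at the origin, to the given entries.\<close>

lemma spectral_rows:
  assumes A: "is_spectral_matrix q b a c t p (Suc k) (mat22 M11 M12 M21 M22)"
  shows "x \<in> self.generic q \<Longrightarrow> self.row q (Dp b t) (Dm b t) (Suc k) M11 M12 x"
    and "x \<in> self.generic q \<Longrightarrow> self.row q (Dp b t) (Dm b t) k M21 M22 x"
    and "poly M11 0 = b 6 * t" "poly M12 0 = 0" "poly M21 0 = 0" "poly M22 0 = b 6 * t"
proof -
  obtain U where U: "\<And>x. x \<in> self.generic q \<Longrightarrow>
    D_minus b t x * \<phi> (q * x) = D_plus b t x * \<phi> x + (q - 1) * x * poly U x"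
    using spectral_poly by blast
  \<comment> \<open>The term (q - 1) x U of the Stieltjes equation. Its zero at the origin is what
    \<open>self_row_at_0\<close> asks for.\<close>
  define N where "N = [:0, q - 1:] * U"
  let ?r1 = "self.row_poly1 q (Dp b t) (Dm b t) N" and ?r2 = "self.row_poly2 q (Dp b t) (Dm b t) N"
  have ex: "self.row q (Dp b t) (Dm b t) m (?r1 m) (?r2 m) x" if "x \<in> self.generic q" for x m
    by (rule self.row_exists[OF that]) (simp add: U[OF that] N_def algebra_simps)
  define R where "R = - ({x. \<not> regular_point q b a c t x} \<union> {x. q * x \<in> {x. \<not> regular_point q b a c t x}})"
  have R: "infinite R"
    unfolding R_def by (intro infinite_Compl_countable countable_Un countable_scaled_vimage q_nz
        countable_irregular q_lt)
  have Rx: "regular_point q b a c t x" "regular_point q b a c t (q * x)" if "x \<in> R" for x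
    using that by (auto simp: R_def)
  have gen: "R \<subseteq> self.generic q"
    using Rx q_nz by (auto simp: self.generic_def regular_point_def)
  have given: "self.row q (Dp b t) (Dm b t) (Suc k) M11 M12 x \<and> self.row q (Dp b t) (Dm b t) k M21 M22 x"
    if x: "x \<in> R" for x
  proof -
    let ?w = "weight q b t"
    have w: "?w x \<noteq> 0" "?w (q * x) \<noteq> 0" "weight_den q b t x \<noteq> 0"
      using Rx[OF x] by (auto simp: regular_point_def weight_def)
    have r: "?w (q * x) * D_minus b t x = D_plus b t x * ?w x"
      by (rule weight_spectral_ratio[OF q_lt b6_nz t_nz w(3)])
    have "scale_mat (D_plus b t x) (Y_mat q b a c t p (Suc k) (q * x)) =
        eval_mat (mat22 M11 M12 M21 M22) x ** Y_mat q b a c t p (Suc k) x"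
      using A Rx[OF x] by (simp add: is_spectral_matrix_def)
    note e = mat22_eqD[OF this[unfolded Y_mat_def diff_Suc_1 second_kind_eq]]
    \<comment> \<open>The weight ratio, solved for D_-: it absorbs the factors 1 / w of the second
      column and replaces D_+ by D_- there.\<close>
    have D: "D_minus b t x = D_plus b t x / ?w (q * x) * ?w x"
      using r w by (simp add: field_simps)
    have "D_minus b t x * Q (p (Suc k)) (q * x) = D_plus b t x * (Q (p (Suc k)) (q * x) / ?w (q * x)) * ?w x"
      "D_minus b t x * Q (p k) (q * x) = D_plus b t x * (Q (p k) (q * x) / ?w (q * x)) * ?w x"
      unfolding D by simp_all
    then show ?thesis
      using w(1) unfolding self.row_def poly_D e(2,4) using e(1,3) by (simp add: distrib_right)
  qed
  have 1: "M11 = ?r1 (Suc k)" "M12 = ?r2 (Suc k)"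
    using self.row_unique[OF R gen, where ?M1.0=M11 and ?M2.0=M12] given ex gen by blast+
  have 2: "M21 = ?r1 k" "M22 = ?r2 k"
    using self.row_unique[OF R gen, where ?M1.0=M21 and ?M2.0=M22] given ex gen by blast+
  show "x \<in> self.generic q \<Longrightarrow> self.row q (Dp b t) (Dm b t) (Suc k) M11 M12 x"
    "x \<in> self.generic q \<Longrightarrow> self.row q (Dp b t) (Dm b t) k M21 M22 x"
    unfolding 1 2 by (rule ex, assumption)+
  have 0: "poly (Dm b t) 0 = poly (Dp b t) 0" "poly N 0 = 0" "poly (Dp b t) 0 = b 6 * t"
    by (simp_all add: N_def D_plus_def D_minus_def)
  show "poly M11 0 = b 6 * t" "poly M12 0 = 0" "poly M21 0 = 0" "poly M22 0 = b 6 * t"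
    unfolding 1 2 self_row_at_0[OF 0(1,2)] 0(3) by (rule refl)+
qed

end

section \<open>The shift in t and the composite shift\<close>

locale deformed_weight_system =
  X: weight_system q b a c t p k + Y: weight_system q b a' c' "q * t" p' k
  for q b a c t p k a' c' p' +
  assumes deformation_eq: "stieltjes_deformation_eq q b a c a' c' t"

sublocale deformed_weight_system \<subseteq> XY: orthonormal_pair
    "weighted_jackson q b a c t" "jackson_support q a c" p
    "weighted_jackson q b a' c' (q * t)" "jackson_support q a' c'" p' k
  by (simp add: orthonormal_pair_def X.orthonormal_polys_axioms Y.orthonormal_polys_axioms)

context deformed_weight_system
begin

lemma deformation_poly:
  "\<exists>T. \<forall>x\<in>XY.generic 1.
    E_minus q b t x * Y.\<phi> x = E_plus q b t x * X.\<phi> x + (q - 1) * t * poly T x"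
proof -
  obtain T where "\<forall>x. x \<noteq> 0 \<and> x \<notin> jackson_support q a c \<and> x \<notin> jackson_support q a' c' \<longrightarrow>
      E_minus q b t x * Y.\<phi> x = E_plus q b t x * X.\<phi> x + (q - 1) * t * poly T x"
    using deformation_eq unfolding stieltjes_deformation_eq_def X.stieltjes_eq Y.stieltjes_eq by blast
  then show ?thesis by (intro exI[of _ T]) (simp add: XY.generic_def)
qed

text \<open>The signs come from normalizing the deformation matrix by -E_+; they make the leading
  coefficients 1 / b6 and b6.\<close>

abbreviation Ep :: "complex poly" where "Ep \<equiv> [:- (q * t), 1 / b 6:]"
abbreviation Em :: "complex poly" where "Em \<equiv> [:- (q * t), b 6:]"

lemma poly_E: "poly Ep x = - E_plus q b t x" "poly Em x = - E_minus q b t x"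
  using X.b6_nz by (simp_all add: E_plus_def E_minus_def field_simps)

text \<open>The same passage from regular to generic points as for the spectral matrix, now between
  two systems and without a shift of x.\<close>

lemma deformation_rows:
  assumes B: "is_deformation_matrix q b a c a' c' t p p' (Suc k) (mat22 M11 M12 M21 M22)"
  shows "x \<in> XY.generic 1 \<Longrightarrow> XY.row 1 Ep Em (Suc k) M11 M12 x"
    and "x \<in> XY.generic 1 \<Longrightarrow> XY.row 1 Ep Em k M21 M22 x"
proof -
  obtain T where T: "\<And>x. x \<in> XY.generic 1 \<Longrightarrow>
    E_minus q b t x * Y.\<phi> x = E_plus q b t x * X.\<phi> x + (q - 1) * t * poly T x"
    using deformation_poly by blast
  define N where "N = smult (- (q - 1) * t) T"
  let ?r1 = "XY.row_poly1 1 Ep Em N" and ?r2 = "XY.row_poly2 1 Ep Em N"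
  have ex: "XY.row 1 Ep Em m (?r1 m) (?r2 m) x" if "x \<in> XY.generic 1" for x m
    by (rule XY.row_exists[OF that]) (unfold poly_E N_def, use T[OF that] in \<open>simp add: algebra_simps\<close>)
  define R where "R = - ({x. \<not> regular_point q b a c t x} \<union> {x. \<not> regular_point q b a' c' (q * t) x})"
  have R: "infinite R"
    unfolding R_def by (intro infinite_Compl_countable countable_Un X.q_nz
        countable_irregular X.q_lt)
  have Rx: "regular_point q b a c t x" "regular_point q b a' c' (q * t) x" if "x \<in> R" for x
    using that by (auto simp: R_def)
  have gen: "R \<subseteq> XY.generic 1"
    using Rx by (auto simp: XY.generic_def regular_point_def)
  have given: "XY.row 1 Ep Em (Suc k) M11 M12 x \<and> XY.row 1 Ep Em k M21 M22 x"
    if x: "x \<in> R" for x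
  proof -
    let ?w = "weight q b t" and ?w' = "weight q b (q * t)"
    have w: "?w x \<noteq> 0" "?w' x \<noteq> 0" "weight_den q b (q * t) x \<noteq> 0"
      using Rx[OF x] by (auto simp: regular_point_def weight_def)
    have r: "?w' x * E_minus q b t x = E_plus q b t x * ?w x"
      by (rule weight_deformation_ratio[OF X.q_lt X.q_nz X.b6_nz X.t_nz w(3)])
    have "scale_mat (- E_plus q b t x) (Y_mat q b a' c' (q * t) p' (Suc k) x) =
        eval_mat (mat22 M11 M12 M21 M22) x ** Y_mat q b a c t p (Suc k) x"
      using B Rx[OF x] by (simp add: is_deformation_matrix_def)
    note e = mat22_eqD[OF this[unfolded Y_mat_def diff_Suc_1 X.second_kind_eq Y.second_kind_eq]]
    have E: "- E_minus q b t x = - E_plus q b t x / ?w' x * ?w x"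
      using r w by (simp add: field_simps)
    have "- E_minus q b t x * Y.Q (p' (Suc k)) x = - E_plus q b t x * (Y.Q (p' (Suc k)) x / ?w' x) * ?w x"
      "- E_minus q b t x * Y.Q (p' k) x = - E_plus q b t x * (Y.Q (p' k) x / ?w' x) * ?w x"
      unfolding E by simp_all
    then show ?thesis
      using w(1) unfolding XY.row_def poly_E e(2,4) mult_1 using e(1,3) by (simp add: distrib_right)
  qed
  have 1: "M11 = ?r1 (Suc k)" "M12 = ?r2 (Suc k)"
    using XY.row_unique[OF R gen, where ?M1.0=M11 and ?M2.0=M12] given ex gen by blast+
  have 2: "M21 = ?r1 k" "M22 = ?r2 k"
    using XY.row_unique[OF R gen, where ?M1.0=M21 and ?M2.0=M22] given ex gen by blast+
  show "x \<in> XY.generic 1 \<Longrightarrow> XY.row 1 Ep Em (Suc k) M11 M12 x"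
    "x \<in> XY.generic 1 \<Longrightarrow> XY.row 1 Ep Em k M21 M22 x"
    unfolding 1 2 by (rule ex, assumption)+
qed

text \<open>The deformation equation at q x followed by the spectral equation at x gives this
  identity multiplied by q (t - b6 x). The point is that this factor also divides the inhomogeneous
  term.\<close>

lemma mixed_shift_poly:
  "\<exists>N. \<forall>\<^sub>F x in at_infinity.
    poly (P23 b) x * Y.\<phi> (q * x) = poly (P14 b) x * X.\<phi> x + poly N x"
proof -
  define G where "G = X.self.generic q \<inter> {x. q * x \<in> XY.generic 1}"
  obtain T where T: "\<And>x. x \<in> XY.generic 1 \<Longrightarrow>
    E_minus q b t x * Y.\<phi> x = E_plus q b t x * X.\<phi> x + (q - 1) * t * poly T x"
    using deformation_poly by blast
  obtain U where U: "\<And>x. x \<in> X.self.generic q \<Longrightarrow>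
    D_minus b t x * X.\<phi> (q * x) = D_plus b t x * X.\<phi> x + (q - 1) * x * poly U x"
    using X.spectral_poly by blast
  define \<Psi> where "\<Psi> x = poly (P23 b) x * Y.\<phi> (q * x) - poly (P14 b) x * X.\<phi> x" for x
  define M where "M = smult q [:t, - b 6:]"
  \<comment> \<open>The inhomogeneous terms of the two equations. The spectral one is weighted by q
    / b6 because E_+(q x) = (q / b6) (b6 t - x), and b6 t - x is the factor of D_- beyond
    \<open>P23\<close>.\<close>
  define N where "N = smult (q / b 6) ([:0, q - 1:] * U) + P23 b * smult ((q - 1) * t) (pcompose T [:0, q:])"
  have N: "poly M x * \<Psi> x = poly N x" if "x \<in> G" for x
  proof -
    have 1: "q * (t - b 6 * x) * Y.\<phi> (q * x) = q / b 6 * (b 6 * t - x) * X.\<phi> (q * x) + (q - 1) * t * poly T (q * x)"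
      using that T[of "q * x"] X.b6_nz by (simp add: G_def E_minus_def E_plus_def field_simps)
    have 2: "q / b 6 * (poly (P23 b) x * (b 6 * t - x) * X.\<phi> (q * x))
        = q / b 6 * (b 6 * (poly (P14 b) x * (t - b 6 * x)) * X.\<phi> x + (q - 1) * x * poly U x)"
    proof -
      have "poly (P23 b) x * (b 6 * t - x) = D_minus b t x" "b 6 * (poly (P14 b) x * (t - b 6 * x)) = D_plus b t x"
        by (simp_all add: P23_def P14_def D_minus_def D_plus_def algebra_simps)
      then show ?thesis using that U by (simp only: G_def IntD1)
    qed
    obtain v where v: "q / b 6 = v" "v * b 6 = q" using X.b6_nz by simp
    have "poly M x * \<Psi> x = poly (P23 b) x * (q * (t - b 6 * x) * Y.\<phi> (q * x))
        - q * (poly (P14 b) x * (t - b 6 * x)) * X.\<phi> x"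
      by (simp add: M_def \<Psi>_def algebra_simps)
    also have "\<dots> = q / b 6 * (poly (P23 b) x * (b 6 * t - x) * X.\<phi> (q * x))
        + poly (P23 b) x * ((q - 1) * t * poly T (q * x)) - q * (poly (P14 b) x * (t - b 6 * x)) * X.\<phi> x"
      unfolding 1 by (simp add: algebra_simps)
    also have "\<dots> = q / b 6 * ((q - 1) * x * poly U x) + poly (P23 b) x * ((q - 1) * t * poly T (q * x))"
      using 2 v(2) unfolding v(1) by algebra
    also have "\<dots> = poly N x" by (simp add: N_def poly_pcompose mult_ac)
    finally show ?thesis .
  qed
  \<comment> \<open>\<open>z\<close> and \<open>q z\<close> are poles of the weight at \<open>t\<close> and \<open>q t\<close>, so they lie off the supports and
    \<open>\<Psi>\<close> stays bounded near \<open>z\<close>. Hence the factor \<open>M\<close> divides out of \<open>N\<close>.\<close>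
  define z where "z = t / b 6"
  have z: "z \<notin> insert 0 (jackson_support q a c)"
  proof -
    have "weight_den q b t z = 0"
      using X.b6_nz X.t_nz by (subst weight_den_rec[OF X.q_lt]) (simp add: z_def)
    then show ?thesis using X.admissible X.b6_nz X.t_nz by (auto simp: admissible_terminals_def z_def)
  qed
  have qz: "q * z \<notin> insert 0 (jackson_support q a' c')"
  proof -
    have "weight_den q b (q * t) (q * z) = 0"
      using X.b6_nz X.t_nz X.q_nz by (subst weight_den_rec[OF X.q_lt]) (simp add: z_def)
    then show ?thesis using Y.admissible X.b6_nz X.t_nz X.q_nz by (auto simp: admissible_terminals_def z_def)
  qed
  have "poly N z = 0"
  proof -
    obtain e1 K1 where e1: "e1 > 0" "\<And>x. x \<in> ball z e1 \<Longrightarrow> norm (X.\<phi> x) \<le> K1"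
      using X.\<phi>_locally_bounded[OF z] by blast
    obtain e2 K2 where e2: "e2 > 0" "\<And>x. x \<in> ball (q * z) e2 \<Longrightarrow> norm (Y.\<phi> x) \<le> K2"
      using Y.\<phi>_locally_bounded[OF qz] by blast
    define e where "e = min e1 e2"
    have bdd: "\<exists>K. \<forall>x\<in>ball z e. norm (poly P x) \<le> K" for P
    proof -
      have "compact (poly P ` cball z e)" by (intro compact_continuous_image continuous_intros) simp
      then show ?thesis by (meson ball_subset_cball bounded_iff compact_imp_bounded imageI subsetD)
    qed
    obtain K3 where K3: "\<And>x. x \<in> ball z e \<Longrightarrow> norm (poly (P23 b) x) \<le> K3" using bdd by blast
    obtain K4 where K4: "\<And>x. x \<in> ball z e \<Longrightarrow> norm (poly (P14 b) x) \<le> K4" using bdd by blast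
    show ?thesis
    proof (rule poly_bound_off_countable)
      show "poly M z = 0" using X.b6_nz by (simp add: M_def z_def)
      show "e > 0" using e1 e2 by (simp add: e_def)
      show "countable (- G)"
      proof -
        have "- G \<subseteq> insert 0 (jackson_support q a c)
            \<union> {x. q * x \<in> insert 0 (jackson_support q a c)} \<union> {x. q * x \<in> insert 0 (jackson_support q a' c')}"
          by (auto simp: G_def X.self.generic_def XY.generic_def)
        moreover have "countable \<dots>"
          by (intro countable_Un countable_scaled_vimage X.q_nz) (simp_all add: jackson_support_def)
        ultimately show ?thesis by (rule countable_subset)
      qed
      fix x assume "x \<in> ball z e - - G"
      then have x: "x \<in> ball z e" "x \<in> G" by auto
      have "q * x \<in> ball (q * z) e2"
      proof -
        have "dist (q * z) (q * x) = norm q * dist z x" by (simp add: dist_norm norm_mult flip: right_diff_distrib)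
        also have "\<dots> \<le> dist z x" using X.q_lt by (simp add: mult_left_le_one_le)
        finally show ?thesis using x by (simp add: e_def)
      qed
      then have 1: "norm (Y.\<phi> (q * x)) \<le> K2" and 2: "norm (X.\<phi> x) \<le> K1" using e1 e2 x by (auto simp: e_def)
      have "norm (\<Psi> x) \<le> K3 * K2 + K4 * K1"
        unfolding \<Psi>_def
        by (intro order_trans[OF norm_triangle_ineq4] add_mono order_trans[OF norm_mult_ineq] mult_mono
            K3 K4 1 2 x norm_ge_zero order_trans[OF norm_ge_zero K3[OF x(1)]] order_trans[OF norm_ge_zero K4[OF x(1)]])
      then show "norm (poly N x) \<le> (K3 * K2 + K4 * K1) * norm (poly M x)"
        unfolding N[OF x(2), symmetric] norm_mult by (subst mult.commute) (rule mult_right_mono, auto)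
    qed
  qed
  then have "[:- z, 1:] dvd N" by (simp add: poly_eq_0_iff_dvd)
  moreover have M: "M = smult (- q * b 6) [:- z, 1:]" using X.b6_nz by (simp add: M_def z_def)
  ultimately have "M dvd N"
    unfolding M using X.q_nz X.b6_nz by (intro smult_dvd) simp_all
  then obtain N' where N': "N = M * N'" by (auto simp: dvd_def)
  have M_nz: "\<forall>\<^sub>F x in at_infinity. poly M x \<noteq> 0"
  proof (rule eventually_at_infinityI[of "norm z + 1"])
    fix x :: complex assume "norm z + 1 \<le> norm x"
    then have "x \<noteq> z" by auto
    then show "poly M x \<noteq> 0" unfolding M using X.q_nz X.b6_nz by simp
  qed
  have "\<forall>\<^sub>F x in at_infinity. poly (P23 b) x * Y.\<phi> (q * x) = poly (P14 b) x * X.\<phi> x + poly N' x"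
    using X.self.eventually_generic[OF X.q_nz] XY.eventually_generic[OF X.q_nz] M_nz
  proof eventually_elim
    case (elim x)
    then have "x \<in> G" by (auto simp: G_def X.self.generic_def XY.generic_def)
    from N[OF this] elim(3) have "\<Psi> x = poly N' x" by (simp add: N')
    then show ?case by (simp add: \<Psi>_def algebra_simps)
  qed
  then show ?thesis by blast
qed

end

section \<open>Elimination of the coefficients of the spectral matrix\<close>

text \<open>In the sum of W_+(g) and W_-(g) the coefficient of g is known by \<open>c1\<close>, and
  by \<open>c5\<close> that of g^2 is a known term plus (1 - b5^2) v2. This determines v2 and
  explains the factor 1 / (1 - b5^2). The left side is the constant term of R_+ over its leading
  coefficient; e1, e2, e3 stand for the elementary symmetric functions of b1, ..., b4.\<close>

lemma painleve_algebra:
  fixes q t f g b5 b6 e1 e2 e3 v1 v2 w1 w2 :: complex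
  assumes c1: "w1 + v1 = - (b6 * t * e1 + 1 + b6\<^sup>2)"
    and c5: "w2 + b5\<^sup>2 * v2 = b5 * (e3 * b6 + t * (1 + b6\<^sup>2))"
    and Wp: "(b6 * t + w1 * g + w2 * g\<^sup>2 - b5 * b6 * g ^ 3) * (1 - f * g)
        = b6 * t * (1 - e1 * g + e2 * g\<^sup>2 - e3 * g ^ 3 + g ^ 4)"
    and Wm: "t * b5 * (b6 * t + v1 * g + v2 * g\<^sup>2) - t * b6 * g ^ 3
        = b5 * (b6 * t - g) * (t - b6 * g) * (1 - f * g)"
    and nz: "g \<noteq> 0" "t \<noteq> 0" "b5 \<noteq> 0" "b6 \<noteq> 0" "1 - b5\<^sup>2 \<noteq> 0" "f * g - 1 \<noteq> 0" "t * g - b5 \<noteq> 0" "f * b5 - t \<noteq> 0"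
  shows "q * g - q * b5 * (b6 + t * f * (1 + b6\<^sup>2) - t * v2) / (b6 * (f * b5 - t))
    = 1 / (1 - b5\<^sup>2) *
              (- (q * (t\<^sup>2 * b6 + g\<^sup>2 * b5\<^sup>2 * b6 - t * g * b5\<^sup>2 * (1 + b6\<^sup>2)) / (g * b6))
               + q * t\<^sup>2 * b5 * (1 - e1 * g + e2 * g\<^sup>2 - e3 * g ^ 3 + g ^ 4)
                   / (g * (f * g - 1) * (t * g - b5))
               - q * (t ^ 4 - e1 * b5 * t ^ 3 + e2 * b5\<^sup>2 * t\<^sup>2 - e3 * b5 ^ 3 * t + b5 ^ 4)
                   / ((t * g - b5) * (f * b5 - t)))"
proof -
  define d1 d2 d3 d4 where "d1 = f * b5 - t" and "d2 = f * g - 1" and "d3 = t * g - b5" and "d4 = 1 - b5\<^sup>2"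
  define Pg Pt where "Pg = 1 - e1 * g + e2 * g\<^sup>2 - e3 * g ^ 3 + g ^ 4"
    and "Pt = t ^ 4 - e1 * b5 * t ^ 3 + e2 * b5\<^sup>2 * t\<^sup>2 - e3 * b5 ^ 3 * t + b5 ^ 4"
  \<comment> \<open>The sum of W_+(g) and W_-(g), multiplied by t b5 (f g - 1) to clear denominators
    and solved for the term with v2.\<close>
  have v2: "t * b5 * d2 * (g\<^sup>2 * d4 * v2) =
      - (t * b5 * (b6 * t * Pg)) - b5 * (b6 * t - g) * (t - b6 * g) * d2\<^sup>2 + t * b5 * d2 * (- 2 * b6 * t + g * (b6 * t * e1 + 1 + b6\<^sup>2)
        - g\<^sup>2 * (b5 * (e3 * b6 + t * (1 + b6\<^sup>2)))) + t * d2 * (b5\<^sup>2 * b6 + b6) * g ^ 3"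
    using c1 c5 Wp Wm unfolding d2_def d4_def Pg_def by algebra
  have key: "g * d1 * d2 * d3 * d4 * g * b6 - d2 * d3 * d4 * g * b5 * (b6 + t * f * (1 + b6\<^sup>2) - t * v2) =
     - (t\<^sup>2 * b6 + g\<^sup>2 * b5\<^sup>2 * b6 - t * g * b5\<^sup>2 * (1 + b6\<^sup>2)) * d1 * d2 * d3
      + t\<^sup>2 * b5 * Pg * b6 * d1 - Pt * d2 * g * b6" (is "?l = ?r")
  proof -
    \<comment> \<open>The factor \<open>t * b5 * g\<close>, cancelled afterwards, turns the v2 term
      of \<open>?l\<close> into a multiple of the left side of \<open>v2\<close>.\<close>
    have "t * b5 * g * ?l = t * b5 * g * ?r"
      using v2 unfolding d1_def d2_def d3_def d4_def Pg_def Pt_def by algebra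
    then show ?thesis using nz by simp
  qed
  have nz': "d1 \<noteq> 0" "d2 \<noteq> 0" "d3 \<noteq> 0" "d4 \<noteq> 0" using nz by (auto simp: d1_def d2_def d3_def d4_def)
  have "q * g - q * b5 * (b6 + t * f * (1 + b6\<^sup>2) - t * v2) / (b6 * d1)
      = q * ?l / (d1 * d2 * d3 * d4 * g * b6)"
    using nz' nz(1,4) by (simp add: divide_simps) (simp add: algebra_simps)
  also have "\<dots> = q * ?r / (d1 * d2 * d3 * d4 * g * b6)" unfolding key ..
  also have "\<dots> = 1 / d4 * (- (q * (t\<^sup>2 * b6 + g\<^sup>2 * b5\<^sup>2 * b6 - t * g * b5\<^sup>2 * (1 + b6\<^sup>2)) / (g * b6))
       + q * t\<^sup>2 * b5 * Pg / (g * d2 * d3) - q * Pt / (d3 * d1))"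
    using nz' nz(1,4) by (simp add: divide_simps) (simp add: algebra_simps)
  finally show ?thesis unfolding d1_def d2_def d3_def d4_def Pg_def Pt_def .
qed

lemma pCons3_eqI:
  assumes "degree P \<le> 3"
  shows "P = [:coeff P 0, coeff P 1, coeff P 2, coeff P 3:]"
proof (rule poly_eqI)
  fix m
  show "coeff P m = coeff [:coeff P 0, coeff P 1, coeff P 2, coeff P 3:] m"
  proof (cases "m \<le> 3")
    case True
    then have "m = 0 \<or> m = 1 \<or> m = 2 \<or> m = 3" by auto
    then show ?thesis by (auto simp: numeral_2_eq_2 numeral_3_eq_3)
  next
    case False
    with assms have "coeff P m = 0" by (intro coeff_eq_0) simp
    then show ?thesis using False by (auto simp: coeff_pCons split: nat.split)
  qed
qed

section \<open>Compatibility of the two shifts\<close>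

text \<open>Two shifts in succession acting on one column, with \<open>z1\<close> and
  \<open>z2\<close> the intermediate values. By \<open>E * D = s * K\<close> the composed and the
  direct row differ only by the factor s.\<close>

lemma row_product:
  fixes y z1 z2 u1 u2 :: complex
  assumes 1: "E * y = B1 * z1 + B2 * z2" and 2: "D * z1 = A11 * u1 + A12 * u2" "D * z2 = A21 * u1 + A22 * u2"
    and 3: "K * y = C1 * u1 + C2 * u2" and 4: "E * D = s * K"
  shows "(B1 * A11 + B2 * A21 - s * C1) * u1 + (B1 * A12 + B2 * A22 - s * C2) * u2 = 0"
proof -
  have "s * (C1 * u1 + C2 * u2) = D * (E * y)"
    unfolding 3[symmetric] using 4 by (simp add: mult_ac)
  also have "\<dots> = B1 * (D * z1) + B2 * (D * z2)"
    unfolding 1 by (simp add: algebra_simps)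
  finally show ?thesis unfolding 2 by (simp add: algebra_simps)
qed

context deformed_weight_system
begin

lemma mixed_shift_row:
  "\<exists>M1 M2. \<forall>\<^sub>F x in at_infinity. XY.row q (P14 b) (P23 b) (Suc k) M1 M2 x"
proof -
  obtain N where N: "\<forall>\<^sub>F x in at_infinity.
      poly (P23 b) x * Y.\<phi> (q * x) = poly (P14 b) x * X.\<phi> x + poly N x"
    using mixed_shift_poly by blast
  have "\<forall>\<^sub>F x in at_infinity. XY.row q (P14 b) (P23 b) (Suc k)
      (XY.row_poly1 q (P14 b) (P23 b) N (Suc k)) (XY.row_poly2 q (P14 b) (P23 b) N (Suc k)) x"
    using N XY.eventually_generic[OF X.q_nz] by eventually_elim (rule XY.row_exists)
  then show ?thesis by blast
qed

text \<open>Going to (q x, q t) by way of (q x, t) or of (x, q t) must agree with the direct shift.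
  The entry (1,2) is the useful one: at a zero of T_+ one of the two products in it drops
  out.\<close>

lemma compatibility:
  assumes A1: "\<And>x. x \<in> X.self.generic q \<Longrightarrow> X.self.row q (Dp b t) (Dm b t) (Suc k) A11 A12 x"
    and A2: "\<And>x. x \<in> X.self.generic q \<Longrightarrow> X.self.row q (Dp b t) (Dm b t) k A21 A22 x"
    and H1: "\<And>x. x \<in> Y.self.generic q \<Longrightarrow> Y.self.row q (Dp b (q * t)) (Dm b (q * t)) (Suc k) H11 H12 x"
    and B1: "\<And>x. x \<in> XY.generic 1 \<Longrightarrow> XY.row 1 Ep Em (Suc k) B11 B12 x"
    and B2: "\<And>x. x \<in> XY.generic 1 \<Longrightarrow> XY.row 1 Ep Em k B21 B22 x"
    and C: "\<forall>\<^sub>F x in at_infinity. XY.row q (P14 b) (P23 b) (Suc k) C1 C2 x"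
  shows "poly B11 (q * x) * poly A12 x + poly B12 (q * x) * poly A22 x
      = - q * (b 6 * t - x) * (t - b 6 * x) * poly C2 x"
    and "poly H11 x * poly B12 x + poly H12 x * poly B22 x
      = - (q * t - b 6 * x) * (b 6 * q * t - x) * poly C2 x"
proof -
  have fin: "\<forall>\<^sub>F x in at_infinity. x \<in> X.self.generic q \<and> x \<in> Y.self.generic q \<and> x \<in> XY.generic 1
      \<and> q * x \<in> XY.generic 1"
    using X.self.eventually_generic[OF X.q_nz] Y.self.eventually_generic[OF X.q_nz]
    by eventually_elim (auto simp: X.self.generic_def Y.self.generic_def XY.generic_def)
  have p1: "\<forall>\<^sub>F x in at_infinity. poly (pcompose B11 [:0, q:] * A12 + pcompose B12 [:0, q:] * A22) x
      = poly (smult (- q) ([:b 6 * t, - 1:] * [:t, - b 6:]) * C2) x"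
    using fin C
  proof eventually_elim
    case (elim x)
    have off: "x \<notin> insert 0 (jackson_support q a c)" using elim by (auto simp: XY.generic_def)
    \<comment> \<open>One scalar serves both columns, since E_+(q x) D_+(x) : E_-(q x) D_-(x) = P14
      : P23. Otherwise the two equations could not be compared with the same row C.\<close>
    define s where "s = - q * (b 6 * t - x) * (t - b 6 * x)"
    have E: "poly Ep (q * x) * poly (Dp b t) x = s * poly (P14 b) x"
      "poly Em (q * x) * poly (Dm b t) x = s * poly (P23 b) x"
      unfolding Dp_def Dm_def poly_smult poly_mult[of "P14 b"] poly_mult[of "P23 b"] s_def
      using X.b6_nz by (simp_all add: divide_simps, simp_all add: algebra_simps)
    have r: "X.self.row q (Dp b t) (Dm b t) (Suc k) A11 A12 x" "X.self.row q (Dp b t) (Dm b t) k A21 A22 x"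
      "XY.row 1 Ep Em (Suc k) B11 B12 (q * x)"
      using elim A1 A2 B1 by blast+
    note r' = r(1,2)[unfolded X.self.row_def] r(3)[unfolded XY.row_def mult_1] elim(2)[unfolded XY.row_def]
    have "(poly B11 (q * x) * poly A11 x + poly B12 (q * x) * poly A21 x - s * poly C1 x) * poly (p (Suc k)) x
      + (poly B11 (q * x) * poly A12 x + poly B12 (q * x) * poly A22 x - s * poly C2 x) * poly (p k) x = 0"
      by (rule row_product[OF conjunct1[OF r'(3)] conjunct1[OF r'(1)] conjunct1[OF r'(2)] conjunct1[OF r'(4)] E(1)])
    moreover have "(poly B11 (q * x) * poly A11 x + poly B12 (q * x) * poly A21 x - s * poly C1 x) * X.Q (p (Suc k)) x
      + (poly B11 (q * x) * poly A12 x + poly B12 (q * x) * poly A22 x - s * poly C2 x) * X.Q (p k) x = 0"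
      by (rule row_product[OF conjunct2[OF r'(3)] conjunct2[OF r'(1)] conjunct2[OF r'(2)] conjunct2[OF r'(4)] E(2)])
    ultimately have "poly B11 (q * x) * poly A12 x + poly B12 (q * x) * poly A22 x - s * poly C2 x = 0"
      by (rule X.casoratian_cancel(2)[OF off])
    moreover have "poly (smult (- q) ([:b 6 * t, - 1:] * [:t, - b 6:]) * C2) x = s * poly C2 x"
      unfolding poly_mult poly_smult by (simp add: s_def)
    ultimately show ?case by (simp add: poly_pcompose mult_ac del: mult_pCons_left mult_pCons_right)
  qed
  show "poly B11 (q * x) * poly A12 x + poly B12 (q * x) * poly A22 x
      = - q * (b 6 * t - x) * (t - b 6 * x) * poly C2 x"
    using arg_cong[OF poly_eqI_at_infinity[OF p1], of "\<lambda>P. poly P x"]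
    unfolding poly_mult poly_smult poly_add by (simp add: poly_pcompose mult_ac)
  have p2: "\<forall>\<^sub>F x in at_infinity. poly (H11 * B12 + H12 * B22) x
      = poly (smult (- 1) ([:q * t, - b 6:] * [:b 6 * q * t, - 1:]) * C2) x"
    using fin C
  proof eventually_elim
    case (elim x)
    have off: "x \<notin> insert 0 (jackson_support q a c)" using elim by (auto simp: XY.generic_def)
    define s where "s = - (q * t - b 6 * x) * (b 6 * q * t - x)"
    have E: "poly (Dp b (q * t)) x * poly Ep x = s * poly (P14 b) x"
      "poly (Dm b (q * t)) x * poly Em x = s * poly (P23 b) x"
      unfolding Dp_def Dm_def poly_smult poly_mult[of "P14 b"] poly_mult[of "P23 b"] s_def
      using X.b6_nz by (simp_all add: divide_simps, simp_all add: algebra_simps)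
    have r: "Y.self.row q (Dp b (q * t)) (Dm b (q * t)) (Suc k) H11 H12 x"
      "XY.row 1 Ep Em (Suc k) B11 B12 x" "XY.row 1 Ep Em k B21 B22 x"
      using elim H1 B1 B2 by blast+
    note r' = r(1)[unfolded Y.self.row_def] r(2,3)[unfolded XY.row_def mult_1] elim(2)[unfolded XY.row_def]
    have "(poly H11 x * poly B11 x + poly H12 x * poly B21 x - s * poly C1 x) * poly (p (Suc k)) x
      + (poly H11 x * poly B12 x + poly H12 x * poly B22 x - s * poly C2 x) * poly (p k) x = 0"
      by (rule row_product[OF conjunct1[OF r'(1)] conjunct1[OF r'(2)] conjunct1[OF r'(3)] conjunct1[OF r'(4)] E(1)])
    moreover have "(poly H11 x * poly B11 x + poly H12 x * poly B21 x - s * poly C1 x) * X.Q (p (Suc k)) x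
      + (poly H11 x * poly B12 x + poly H12 x * poly B22 x - s * poly C2 x) * X.Q (p k) x = 0"
      by (rule row_product[OF conjunct2[OF r'(1)] conjunct2[OF r'(2)] conjunct2[OF r'(3)] conjunct2[OF r'(4)] E(2)])
    ultimately have f1: "poly H11 x * poly B12 x + poly H12 x * poly B22 x - s * poly C2 x = 0"
      by (rule X.casoratian_cancel(2)[OF off])
    have f2: "poly (smult (- 1) ([:q * t, - b 6:] * [:b 6 * q * t, - 1:]) * C2) x = s * poly C2 x"
      unfolding poly_mult poly_smult s_def poly_pCons poly_0 by (simp only: minus_mult_left[symmetric]) (simp add: algebra_simps)
    show ?case unfolding f2 using f1 by simp
  qed
  show "poly H11 x * poly B12 x + poly H12 x * poly B22 x
      = - (q * t - b 6 * x) * (b 6 * q * t - x) * poly C2 x"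
    using arg_cong[OF poly_eqI_at_infinity[OF p2], of "\<lambda>P. poly P x"]
    unfolding poly_mult poly_smult poly_add poly_pCons poly_0 by algebra
qed

end

lemma poly_cubic:
  fixes P :: "complex poly"
  assumes "degree P \<le> 3"
  shows "poly P x = coeff P 0 + coeff P 1 * x + coeff P 2 * x\<^sup>2 + coeff P 3 * x ^ 3"
  by (subst pCons3_eqI[OF assms]) (simp add: algebra_simps power2_eq_square power3_eq_cube)

lemma cubic_eq_0:
  fixes a0 a1 a2 a3 :: complex
  assumes "\<And>x. a0 + a1 * x + a2 * x\<^sup>2 + a3 * x ^ 3 = 0"
  shows "a2 = 0" "a3 = 0"
proof -
  have "poly [:a0, a1, a2, a3:] x = 0" for x
    using assms[of x] by (simp add: algebra_simps power2_eq_square power3_eq_cube)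
  then have "[:a0, a1, a2, a3:] = 0" using poly_all_0_iff_0 by blast
  then show "a2 = 0" "a3 = 0" by simp_all
qed

lemma poly_root_of_div:
  fixes P :: "complex poly"
  assumes "poly P 0 = 0" "poly (P div [:0, 1:]) g = 0"
  shows "poly P g = 0"
proof -
  have "[:0, 1:] dvd P" using assms(1) poly_eq_0_iff_dvd[of P 0] by simp
  then have "P = [:0, 1:] * (P div [:0, 1:])" by (simp only: dvd_mult_div_cancel)
  then have "poly P g = g * poly (P div [:0, 1:]) g"
    by (metis poly_mult poly_pCons poly_0 mult_zero_right add_0 add.right_neutral mult_1_right)
  then show ?thesis using assms(2) by simp
qed

text \<open>The off-diagonal product contains only the powers x^2 to x^4, so the coefficients of x
  and x^5 involve the diagonal entries alone.\<close>

lemma det_coeffs: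
  fixes b :: "nat \<Rightarrow> complex"
  assumes eq: "[:x0, w1, w2, w3:] * [:x0, v1, v2, v3:] + [:0, a1, a2:] * [:0, s1, s2:] = Dp b t * Dm b t"
    and b_prod: "b 1 * b 2 * b 3 * b 4 = 1"
  shows "x0 * (w1 + v1) = - b 6 * t * (b 6 * t * (b 1 + b 2 + b 3 + b 4) + 1 + (b 6)\<^sup>2)"
    and "w2 * v3 + w3 * v2 = - b 6 * ((b 1 * b 2 * b 3 + b 1 * b 2 * b 4 + b 1 * b 3 * b 4 + b 2 * b 3 * b 4) * b 6
      + t * (1 + (b 6)\<^sup>2))"
proof -
  have "x0 * v1 + w1 * x0 = coeff (Dp b t * Dm b t) 1"
    unfolding eq[symmetric] by simp
  also have "\<dots> = - b 6 * t * (b 6 * t * (b 1 + b 2 + b 3 + b 4) + 1 + (b 6)\<^sup>2)"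
    by (simp add: Dp_def Dm_def P14_def P23_def algebra_simps power2_eq_square)
  finally show "x0 * (w1 + v1) = \<dots>" by (simp add: algebra_simps)
  have "w2 * v3 + w3 * v2 = coeff (Dp b t * Dm b t) (Suc (Suc (Suc (Suc (Suc 0)))))"
    unfolding eq[symmetric] by simp
  also have "\<dots> = - b 6 * ((b 1 * b 2 * b 3 + b 1 * b 2 * b 4 + b 1 * b 3 * b 4 + b 2 * b 3 * b 4) * b 6
      + (b 1 * b 2 * b 3 * b 4) * (t * (1 + (b 6)\<^sup>2)))"
    by (simp add: Dp_def Dm_def P14_def P23_def algebra_simps power2_eq_square)
  finally show "w2 * v3 + w3 * v2 = - b 6 * ((b 1 * b 2 * b 3 + b 1 * b 2 * b 4 + b 1 * b 3 * b 4 + b 2 * b 3 * b 4) * b 6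
      + t * (1 + (b 6)\<^sup>2))" unfolding b_prod by simp
qed

section \<open>The entries of the deformation matrix\<close>

context deformed_weight_system
begin

text \<open>One quantity r carries the constant terms of both diagonal entries; the one of R_- is
  left in the form that the determinant of B delivers.\<close>

lemma deformation_matrix_entries:
  fixes b5 g g' f r :: complex
  assumes b_prod: "b 1 * b 2 * b 3 * b 4 = 1"
    and b5: "b5 = b 1 * b 4 * b 6 * q ^ Suc k"
    and A: "is_spectral_matrix q b a c t p (Suc k) (mat22 Wp (- Tp) Tm Wm)"
    and H: "is_spectral_matrix q b a' c' (q * t) p' (Suc k) (mat22 Wp' (- Tp') Tm' Wm')"
    and B: "is_deformation_matrix q b a c a' c' t p p' (Suc k) (mat22 Rp (- Pp) Pm Rm)"
    and g: "poly (Tp div [:0, 1:]) g = 0" "g \<noteq> 0" "g \<noteq> b 6 * t" "g \<noteq> t / b 6"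
    and g': "poly (Tp' div [:0, 1:]) g' = 0" "g' \<noteq> 0" "g' \<noteq> b 6 * (q * t)" "g' \<noteq> q * t / b 6"
    and f: "poly Wp' g' = - (1 / (q * t)) * (g' - b 6 * (q * t)) * (b 6 * g' - q * t) * (f * g' - 1)"
    and b5_ne: "b5\<^sup>2 \<noteq> 1 / q" "b5\<^sup>2 \<noteq> 1"
    and den: "f * g - 1 \<noteq> 0" "t * g - b5 \<noteq> 0" "f * b5 - t \<noteq> 0"
    and r: "r = 1 / (1 - b5\<^sup>2) *
              (- (q * (t\<^sup>2 * b 6 + g\<^sup>2 * b5\<^sup>2 * b 6 - t * g * b5\<^sup>2 * (1 + (b 6)\<^sup>2)) / (g * b 6))
               + q * t\<^sup>2 * b5 * (\<Prod>j=1..4. 1 - b j * g) / (g * (f * g - 1) * (t * g - b5))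
               - q * (\<Prod>j=1..4. t - b j * b5) / ((t * g - b5) * (f * b5 - t)))"
  shows "poly Rp x = Y.\<gamma> (Suc k) / (b 6 * X.\<gamma> (Suc k)) * (x + r)"
    and "poly Rm x = b 6 * X.\<gamma> k / Y.\<gamma> k * (x - r - q * t * (1 + (b 6)\<^sup>2) / b 6)"
    and "poly Pp x = X.\<gamma> k / X.\<gamma> (Suc k) *
        (Y.\<gamma> (Suc k) / (b 6 * X.\<gamma> (Suc k)) - b 6 * X.\<gamma> (Suc k) / Y.\<gamma> (Suc k))"
    and "poly Pm x = X.\<gamma> k / X.\<gamma> (Suc k) *
        (Y.\<gamma> k / (b 6 * X.\<gamma> k) - b 6 * X.\<gamma> k / Y.\<gamma> k)"
proof -
  define u v \<alpha> where "u = Y.\<gamma> (Suc k) / X.\<gamma> (Suc k)" and "v = Y.\<gamma> k / X.\<gamma> k"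
    and "\<alpha> = X.\<gamma> k / X.\<gamma> (Suc k)"
  have uv: "u \<noteq> 0" "v \<noteq> 0" "\<alpha> \<noteq> 0"
    using X.\<gamma>_nonzero Y.\<gamma>_nonzero by (simp_all add: u_def v_def \<alpha>_def)
  note nz = X.q_nz X.t_nz X.b6_nz
  have b_nz: "b 1 \<noteq> 0" "b 2 \<noteq> 0" "b 3 \<noteq> 0" "b 4 \<noteq> 0" using b_prod by auto
  have b5_nz: "b5 \<noteq> 0" using b5 b_nz nz by simp
  have b14: "b 1 * b 4 * q ^ Suc k = b5 / b 6" using b5 nz by simp
  have b23: "b 2 * b 3 / q ^ Suc k = b 6 / b5"
  proof -
    have "b 2 * b 3 * b5 = (b 1 * b 2 * b 3 * b 4) * (b 6 * q ^ Suc k)" unfolding b5 by (simp add: mult_ac)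
    then have "b 2 * b 3 * b5 = b 6 * q ^ Suc k" unfolding b_prod by simp
    then show ?thesis using b5_nz nz by (simp add: frac_eq_eq del: power_Suc)
  qed
  \<comment> \<open>The exponent k + 2 is the order of decay of the function of the second kind with
    index n = k + 1.\<close>
  have b23': "b 2 * b 3 / q ^ (k + 2) = b 6 / (b5 * q)"
  proof -
    have "b 2 * b 3 / q ^ (k + 2) = b 2 * b 3 / q ^ Suc k / q" by simp
    then show ?thesis unfolding b23 by simp
  qed
  note rowsA = X.spectral_rows[OF A]
  note rowsH = Y.spectral_rows[OF H]
  note rowsB = deformation_rows[OF B]
  note evA = X.self.eventually_generic[OF X.q_nz]
  note evB = XY.eventually_generic[OF one_neq_zero]
  have eA: "\<forall>\<^sub>F x in at_infinity. X.self.row q (Dp b t) (Dm b t) (Suc k) Wp (- Tp) x"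
    "\<forall>\<^sub>F x in at_infinity. X.self.row q (Dp b t) (Dm b t) k Tm Wm x"
    using evA by (auto elim!: eventually_mono intro: rowsA)
  have eB: "\<forall>\<^sub>F x in at_infinity. XY.row 1 Ep Em (Suc k) Rp (- Pp) x"
    "\<forall>\<^sub>F x in at_infinity. XY.row 1 Ep Em k Pm Rm x"
    using evB by (auto elim!: eventually_mono intro: rowsB)
  obtain C1 C2 where C: "\<forall>\<^sub>F x in at_infinity. XY.row q (P14 b) (P23 b) (Suc k) C1 C2 x"
    using mixed_shift_row by blast

  have dD: "degree (Dp b t) \<le> Suc 2" "degree (Dm b t) \<le> Suc 2"
    "coeff (Dp b t) (Suc 2) = - b 1 * b 4 * (b 6)\<^sup>2" "coeff (Dm b t) (Suc 2) = - b 2 * b 3"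
    using D_coeffs[of b t] by simp_all
  have Wp3: "degree Wp \<le> 3" "coeff Wp 3 = - (b5 * b 6)"
    using X.self.upper_row_diag[OF X.q_nz dD(1,2) eA(1)] X.\<gamma>_nonzero unfolding dD
    by (simp_all add: b5 power2_eq_square)
  have Wm3: "degree Wm \<le> 3" "coeff Wm 3 = - (b 6 / b5)"
    using X.self.lower_row_diag[OF X.q_nz dD(1,2) eA(2)] X.\<gamma>_nonzero unfolding dD
    by (simp_all flip: b23)
  have Tp2: "degree Tp \<le> 2" "coeff Tp 2 = \<alpha> * (b 6 / (b5 * q) - b5 * b 6)"
  proof -
    note T = X.self.upper_row_off_diag[OF X.q_nz dD(1,2) eA(1), folded \<alpha>_def]
    show "degree Tp \<le> 2" using T(1) by simp
    have "- coeff Tp 2 = \<alpha> * (- (b 2 * b 3 / q ^ (k + 2)) + (b 1 * b 4 * q ^ Suc k) * (b 6)\<^sup>2)"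
      using T(2) X.\<gamma>_nonzero unfolding dD by (simp add: field_simps)
    then show "coeff Tp 2 = \<alpha> * (b 6 / (b5 * q) - b5 * b 6)"
      unfolding b14 b23' using nz by (simp add: field_simps power2_eq_square)
  qed
  have Tm2: "degree Tm \<le> 2"
    by (rule X.self.lower_row_off_diag(1)[OF X.q_nz dD(1,2) eA(2)])

  have dE: "degree Ep \<le> Suc 0" "degree Em \<le> Suc 0" "coeff Ep (Suc 0) = 1 / b 6" "coeff Em (Suc 0) = b 6"
    by simp_all
  have Rp1: "degree Rp \<le> 1" "coeff Rp 1 = u / b 6"
    using XY.upper_row_diag[OF one_neq_zero dE(1,2) eB(1)] by (simp_all add: u_def)
  have Rm1: "degree Rm \<le> 1" "coeff Rm 1 = b 6 / v"
    using XY.lower_row_diag[OF one_neq_zero dE(1,2) eB(2)] by (simp_all add: v_def)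
  have Pp0: "degree Pp = 0" "coeff Pp 0 = \<alpha> * (u / b 6 - b 6 / u)"
    using XY.upper_row_off_diag[OF one_neq_zero dE(1,2) eB(1), folded \<alpha>_def]
    by (simp_all add: u_def algebra_simps)
  have Pm0: "degree Pm = 0" "coeff Pm 0 = \<alpha> * (v / b 6 - b 6 / v)"
    using XY.lower_row_off_diag[OF one_neq_zero dE(1,2) eB(2), folded \<alpha>_def]
    by (simp_all add: v_def algebra_simps)
  define \<pi> where "\<pi> = \<alpha> * (u / b 6 - b 6 / u)"
  have Pp: "poly Pp x = \<pi>" for x
    using Pp0 by (auto elim!: degree_eq_zeroE simp: \<pi>_def)
  have Pm: "poly Pm x = \<alpha> * (v / b 6 - b 6 / v)" for x
    using Pm0 by (auto elim!: degree_eq_zeroE)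
  show "poly Pp x = X.\<gamma> k / X.\<gamma> (Suc k) *
        (Y.\<gamma> (Suc k) / (b 6 * X.\<gamma> (Suc k)) - b 6 * X.\<gamma> (Suc k) / Y.\<gamma> (Suc k))"
    unfolding Pp \<pi>_def by (simp add: u_def \<alpha>_def mult_ac)
  show "poly Pm x = X.\<gamma> k / X.\<gamma> (Suc k) *
        (Y.\<gamma> k / (b 6 * X.\<gamma> k) - b 6 * X.\<gamma> k / Y.\<gamma> k)"
    unfolding Pm by (simp add: v_def \<alpha>_def mult_ac)
  have dC: "degree (P14 b) \<le> Suc 1" "degree (P23 b) \<le> Suc 1"
    "coeff (P14 b) (Suc 1) = b 1 * b 4" "coeff (P23 b) (Suc 1) = b 2 * b 3"
    using P14_P23_coeffs[of b] by (simp_all add: numeral_2_eq_2)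
  have C21: "degree C2 \<le> 1" "coeff C2 1 = \<alpha> * (b 6 / (b5 * q * u) - b5 * u / b 6)"
  proof -
    note T = XY.upper_row_off_diag[OF X.q_nz dC(1,2) C, folded \<alpha>_def]
    show "degree C2 \<le> 1" by (rule T(1))
    have "coeff C2 1 = \<alpha> * (b 2 * b 3 / q ^ (k + 2) / u - (b 1 * b 4 * q ^ Suc k) * u)"
      using T(2) unfolding dC u_def by (simp add: field_simps)
    then show "coeff C2 1 = \<alpha> * (b 6 / (b5 * q * u) - b5 * u / b 6)"
      unfolding b14 b23' by simp
  qed

  define r0 where "r0 = poly Rp 0"
  have Rp: "poly Rp x = u / b 6 * x + r0" for x
    using poly_cubic[of Rp x] Rp1 by (simp add: coeff_eq_0 r0_def poly_0_coeff_0)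
  define s0 where "s0 = poly Rm 0"
  have Rm: "poly Rm x = b 6 / v * x + s0" for x
    using poly_cubic[of Rm x] Rm1 by (simp add: coeff_eq_0 s0_def poly_0_coeff_0)
  define c0 c1 where "c0 = poly C2 0" and "c1 = coeff C2 1"
  have C2: "poly C2 x = c0 + c1 * x" for x
    using poly_cubic[of C2 x] C21 by (simp add: coeff_eq_0 c0_def c1_def poly_0_coeff_0)
  define \<tau> where "\<tau> = coeff Tp 2"
  have Tp_g: "poly Tp g = 0" and Tp'_g': "poly Tp' g' = 0"
    using rowsA(4) rowsH(4) by (auto intro!: poly_root_of_div g(1) g'(1))
  have Tp_x: "poly Tp x = coeff Tp 1 * x + \<tau> * x\<^sup>2" for x
    using poly_cubic[of Tp x] Tp2(1) rowsA(4) by (simp add: coeff_eq_0 \<tau>_def poly_0_coeff_0)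
  have Tp: "poly Tp x = \<tau> * x * (x - g)" for x
  proof -
    have "g * (coeff Tp 1 + \<tau> * g) = 0"
      using Tp_g unfolding Tp_x by (simp add: algebra_simps power2_eq_square)
    then have "coeff Tp 1 = - \<tau> * g" using g(2) by (simp add: add_eq_0_iff2)
    then show ?thesis unfolding Tp_x by (simp add: algebra_simps power2_eq_square)
  qed
  define w1 w2 v1 v2 where "w1 = coeff Wp 1" and "w2 = coeff Wp 2" and "v1 = coeff Wm 1" and "v2 = coeff Wm 2"
  have Wp_eq: "Wp = [:b 6 * t, w1, w2, - (b5 * b 6):]" and Wm_eq: "Wm = [:b 6 * t, v1, v2, - (b 6 / b5):]"
    using pCons3_eqI[OF Wp3(1)] pCons3_eqI[OF Wm3(1)] Wp3(2) Wm3(2) rowsA(3,6)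
    by (simp_all add: w1_def w2_def v1_def v2_def poly_0_coeff_0)
  have Wp: "poly Wp x = b 6 * t + w1 * x + w2 * x\<^sup>2 - b5 * b 6 * x ^ 3" for x
    unfolding Wp_eq by (simp add: algebra_simps power2_eq_square power3_eq_cube)
  have Wm: "poly Wm x = b 6 * t + v1 * x + v2 * x\<^sup>2 - b 6 / b5 * x ^ 3" for x
    unfolding Wm_eq by (simp add: algebra_simps power2_eq_square power3_eq_cube)
  have Tp_eq: "Tp = [:0, coeff Tp 1, coeff Tp 2:]" and Tm_eq: "Tm = [:0, coeff Tm 1, coeff Tm 2:]"
    using pCons3_eqI[of Tp] pCons3_eqI[of Tm] Tp2(1) Tm2 rowsA(4,5)
    by (simp_all add: coeff_eq_0 poly_0_coeff_0)
  have detA: "Wp * Wm + Tp * Tm = Dp b t * Dm b t"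
  proof (rule poly_eqI_at_infinity)
    show "\<forall>\<^sub>F x in at_infinity. poly (Wp * Wm + Tp * Tm) x = poly (Dp b t * Dm b t) x"
      using evA
    proof eventually_elim
      case (elim x)
      show ?case
        using X.self.row_det[OF elim rowsA(1)[OF elim] rowsA(2)[OF elim]] X.\<gamma>_nonzero by simp
    qed
  qed
  have detA': "[:b 6 * t, w1, w2, - (b5 * b 6):] * [:b 6 * t, v1, v2, - (b 6 / b5):]
      + [:0, coeff Tp 1, coeff Tp 2:] * [:0, coeff Tm 1, coeff Tm 2:] = Dp b t * Dm b t"
    using detA Wp_eq Wm_eq Tp_eq Tm_eq by metis
  define e1 e2 e3 where "e1 = b 1 + b 2 + b 3 + b 4"
    and "e2 = b 1 * b 2 + b 1 * b 3 + b 1 * b 4 + b 2 * b 3 + b 2 * b 4 + b 3 * b 4"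
    and "e3 = b 1 * b 2 * b 3 + b 1 * b 2 * b 4 + b 1 * b 3 * b 4 + b 2 * b 3 * b 4"
  note dc = det_coeffs[OF detA' b_prod, folded e1_def e3_def]
  have coeff1: "w1 + v1 = - (b 6 * t * e1 + 1 + (b 6)\<^sup>2)"
  proof -
    have "b 6 * t * (w1 + v1) = b 6 * t * - (b 6 * t * e1 + 1 + (b 6)\<^sup>2)"
      using dc(1) by (simp add: algebra_simps)
    then show ?thesis using nz by simp
  qed
  have coeff5: "w2 + b5\<^sup>2 * v2 = b5 * (e3 * b 6 + t * (1 + (b 6)\<^sup>2))"
  proof -
    have "b 6 * (w2 / b5 + b5 * v2) = b 6 * (e3 * b 6 + t * (1 + (b 6)\<^sup>2))"
      using dc(2) by (simp add: algebra_simps)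
    then have "w2 / b5 + b5 * v2 = e3 * b 6 + t * (1 + (b 6)\<^sup>2)" using nz by simp
    then have "b5 * (w2 / b5 + b5 * v2) = b5 * (e3 * b 6 + t * (1 + (b 6)\<^sup>2))" by simp
    then show ?thesis using b5_nz by (simp add: distrib_left power2_eq_square mult.assoc)
  qed
  have elem: "(\<Prod>j=1..4. 1 - b j * g) = 1 - e1 * g + e2 * g\<^sup>2 - e3 * g ^ 3 + g ^ 4"
    "(\<Prod>j=1..4. t - b j * b5) = t ^ 4 - e1 * b5 * t ^ 3 + e2 * b5\<^sup>2 * t\<^sup>2 - e3 * b5 ^ 3 * t + b5 ^ 4"
  proof -
    have 4: "(\<Prod>j=1..4. F j) = F 1 * F 2 * F 3 * F 4" for F :: "nat \<Rightarrow> complex"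
      by (simp add: numeral_eq_Suc)
    have "(1 - b 1 * g) * (1 - b 2 * g) * (1 - b 3 * g) * (1 - b 4 * g)
        = 1 - e1 * g + e2 * g\<^sup>2 - e3 * g ^ 3 + (b 1 * b 2 * b 3 * b 4) * g ^ 4"
      unfolding e1_def e2_def e3_def by algebra
    then show "(\<Prod>j=1..4. 1 - b j * g) = 1 - e1 * g + e2 * g\<^sup>2 - e3 * g ^ 3 + g ^ 4"
      unfolding 4 b_prod by simp
    have "(t - b 1 * b5) * (t - b 2 * b5) * (t - b 3 * b5) * (t - b 4 * b5)
        = t ^ 4 - e1 * b5 * t ^ 3 + e2 * b5\<^sup>2 * t\<^sup>2 - e3 * b5 ^ 3 * t + (b 1 * b 2 * b 3 * b 4) * b5 ^ 4"
      unfolding e1_def e2_def e3_def by algebra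
    then show "(\<Prod>j=1..4. t - b j * b5) = t ^ 4 - e1 * b5 * t ^ 3 + e2 * b5\<^sup>2 * t\<^sup>2 - e3 * b5 ^ 3 * t + b5 ^ 4"
      unfolding 4 b_prod by simp
  qed

  note compat = compatibility[OF rowsA(1,2) rowsH(1) rowsB C, unfolded poly_minus Pp]
  \<comment> \<open>The first relation at x = 0, where T_+ vanishes and W_- equals b6 t.\<close>
  have c0: "c0 = \<pi> / (q * t)"
  proof -
    have "\<pi> * (b 6 * t) = q * (b 6 * t) * t * c0"
      using compat(1)[of 0] Tp[of 0] rowsA(6) by (simp add: C2)
    then show ?thesis using nz by (simp add: field_simps)
  qed
  \<comment> \<open>The second relation at g', where T_+(x; q t) vanishes. The quadratic factor in
    the definition of f is, at q t, the scalar of this relation and cancels, leaving c0 + c1 g' =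
    \<pi> (1 - f g') / (q t), whose constant term is c0.\<close>
  have c1g: "g' * c1 = g' * (- \<pi> * f / (q * t))"
  proof -
    define z where "z = (b 6 * q * t - g') * (q * t - b 6 * g')"
    have "b 6 * q * t - g' \<noteq> 0" "q * t - b 6 * g' \<noteq> 0"
      using g'(3,4) nz by (simp_all add: eq_divide_eq mult_ac)
    then have z: "z \<noteq> 0" by (simp add: z_def)
    have "poly Wp' g' * \<pi> = z * (c0 + c1 * g')"
      using compat(2)[of g'] unfolding Tp'_g' C2 by (simp add: z_def algebra_simps)
    moreover have "poly Wp' g' = - (1 / (q * t)) * z * (f * g' - 1)"
      unfolding f z_def by (simp add: algebra_simps)
    ultimately have "z * (- (1 / (q * t)) * (f * g' - 1) * \<pi>) = z * (c0 + c1 * g')"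
      by (simp add: mult_ac)
    then have "- (1 / (q * t)) * (f * g' - 1) * \<pi> = c0 + c1 * g'" by (simp only: mult_left_cancel[OF z])
    then show ?thesis unfolding c0
      by (simp add: algebra_simps diff_divide_distrib add_divide_distrib eq_neg_iff_add_eq_0)
  qed
  then have c1: "c1 = - \<pi> * f / (q * t)" by (simp only: mult_left_cancel[OF g'(2)])
  \<comment> \<open>If \<open>P\<^sub>+\<close> vanished, both coefficients of \<open>C2\<close> would vanish, which forces \<open>q b5\<^sup>2 = 1\<close>.\<close>
  have \<pi>_nz: "\<pi> \<noteq> 0"
  proof
    assume \<pi>: "\<pi> = 0"
    then have "u\<^sup>2 = (b 6)\<^sup>2"
      using uv nz unfolding \<pi>_def by (simp add: field_simps power2_eq_square)
    moreover have "(b 6)\<^sup>2 = q * b5\<^sup>2 * u\<^sup>2"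
      using c1[unfolded c1_def C21(2)] \<pi> uv nz b5_nz by (simp add: field_simps power2_eq_square)
    ultimately have "q * b5\<^sup>2 = 1" using nz uv by simp
    then show False using b5_ne(1) nz by (simp add: field_simps)
  qed
  have C2': "poly C2 x = \<pi> / (q * t) * (1 - f * x)" for x
    unfolding C2 c0 c1 by (simp add: algebra_simps diff_divide_distrib)
  \<comment> \<open>The first relation at g, where T_+(x; t) vanishes and the nonzero constant P_+
    cancels.\<close>
  have Wm_g: "t * poly Wm g = (b 6 * t - g) * (t - b 6 * g) * (1 - f * g)"
  proof -
    have "\<pi> * poly Wm g = q * (b 6 * t - g) * (t - b 6 * g) * (\<pi> / (q * t) * (1 - f * g))"
      using compat(1)[of g] unfolding Tp_g C2' by simp
    then have "\<pi> * (t * poly Wm g) = t * (q * (b 6 * t - g) * (t - b 6 * g) * (\<pi> / (q * t) * (1 - f * g)))"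
      by (metis mult.left_commute)
    also have "\<dots> = \<pi> * ((b 6 * t - g) * (t - b 6 * g) * (1 - f * g))"
      using nz by simp
    finally show ?thesis by (simp only: mult_left_cancel[OF \<pi>_nz])
  qed
  \<comment> \<open>At g the determinant of A reduces to W_+ W_-. With the value of W_-(g) inserted,
    the factor (b6 t - g)(t - b6 g) occurs on both sides and is nonzero by genericity of g.\<close>
  have Wp_g: "poly Wp g * (1 - f * g) = b 6 * t * (1 - e1 * g + e2 * g\<^sup>2 - e3 * g ^ 3 + g ^ 4)"
  proof -
    define z where "z = (b 6 * t - g) * (t - b 6 * g)"
    have "b 6 * t - g \<noteq> 0" "t - b 6 * g \<noteq> 0"
      using g(3,4) nz by (simp_all add: eq_divide_eq mult_ac)
    then have z: "z \<noteq> 0" by (simp add: z_def)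
    have "poly Wp g * poly Wm g = D_plus b t g * D_minus b t g"
      using arg_cong[OF detA, of "\<lambda>P. poly P g"] Tp_g by simp
    also have "\<dots> = b 6 * z * ((1 - b 1 * g) * (1 - b 2 * g) * (1 - b 3 * g) * (1 - b 4 * g))"
      by (simp add: D_plus_def D_minus_def z_def)
    also have "(1 - b 1 * g) * (1 - b 2 * g) * (1 - b 3 * g) * (1 - b 4 * g) = (\<Prod>j=1..4. 1 - b j * g)"
      by (simp add: numeral_eq_Suc)
    finally have "poly Wp g * (t * poly Wm g) = t * (b 6 * z * (\<Prod>j=1..4. 1 - b j * g))" by simp
    then have "z * (poly Wp g * (1 - f * g)) = z * (b 6 * t * (\<Prod>j=1..4. 1 - b j * g))"
      unfolding Wm_g z_def[symmetric] by (simp only: mult_ac)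
    then show ?thesis unfolding elem(1) by (simp only: mult_left_cancel[OF z])
  qed
  define \<rho> where "\<rho> = q * g - q * b5 * (b 6 + t * f * (1 + (b 6)\<^sup>2) - t * v2) / (b 6 * (f * b5 - t))"
  have "\<rho> = r"
    unfolding \<rho>_def r elem
  proof (rule painleve_algebra[OF coeff1 coeff5])
    show "(b 6 * t + w1 * g + w2 * g\<^sup>2 - b5 * b 6 * g ^ 3) * (1 - f * g)
        = b 6 * t * (1 - e1 * g + e2 * g\<^sup>2 - e3 * g ^ 3 + g ^ 4)"
      using Wp_g unfolding Wp .
    have "b5 * (t * poly Wm g) = b5 * ((b 6 * t - g) * (t - b 6 * g) * (1 - f * g))" unfolding Wm_g ..
    then show "t * b5 * (b 6 * t + v1 * g + v2 * g\<^sup>2) - t * b 6 * g ^ 3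
        = b5 * (b 6 * t - g) * (t - b 6 * g) * (1 - f * g)"
      unfolding Wm using b5_nz by (simp add: distrib_left right_diff_distrib mult_ac)
  qed (use g nz b5_nz b5_ne den in auto)
  have r0: "r0 = u / b 6 * r"
  proof -
    define m h c where "m = u / b 6" and "h = \<pi> / t" and "c = \<pi> / (q * t)"
    have qc: "q * c = h" "\<pi> = h * t" using nz by (simp_all add: c_def h_def)
    have I: "(u / b 6 * (q * x) + r0) * (\<tau> * x * (x - g)) + \<pi> * poly Wm x
        = (b 6 * t - x) * (t - b 6 * x) * (\<pi> / t * (1 - f * x))" for x
      using compat(1)[of x] qc(1) unfolding Rp Tp C2' m_def[symmetric] h_def[symmetric] c_def[symmetric]
      by algebra
    \<comment> \<open>The first relation sorted by powers of x. The cube gives \<tau> as a multiple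
      of \<pi>, the square gives \<tau> times an expression in r0; in the quotient both \<tau> and
      \<pi> disappear, which leads to \<rho>.\<close>
    have id: "(\<pi> * b 6 * t - \<pi> * b 6 * t)
        + (\<pi> * v1 - r0 * \<tau> * g + \<pi> * (1 + (b 6)\<^sup>2) + \<pi> * b 6 * t * f) * x
        + (\<tau> * (r0 - u / b 6 * q * g) + \<pi> * v2 - \<pi> / t * (b 6 + t * f * (1 + (b 6)\<^sup>2))) * x\<^sup>2
        + (u / b 6 * q * \<tau> - \<pi> * (b 6 / b5) + \<pi> / t * b 6 * f) * x ^ 3 = 0" for x
    proof -
      obtain d where d: "b 6 / b5 = d" by simp
      show ?thesis
        using I[of x] qc(2) unfolding Wm m_def[symmetric] h_def[symmetric] d by algebra
    qed
    note coeffs = cubic_eq_0[OF id]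
    have 3: "u / b 6 * q * \<tau> = \<pi> * b 6 * (t - b5 * f) / (b5 * t)"
      using coeffs(2) nz b5_nz by (simp add: field_simps)
    have 2: "\<tau> * (r0 - u / b 6 * q * g) = \<pi> / t * (b 6 + t * f * (1 + (b 6)\<^sup>2) - t * v2)"
      using coeffs(1) nz by (simp add: field_simps)
    have d: "b 6 * (f * b5 - t) \<noteq> 0" using nz den(3) by simp
    have \<tau>_nz: "\<tau> \<noteq> 0" using 3 \<pi>_nz nz b5_nz den(3) by (auto simp: mult.commute)
    have "\<tau> * (r0 - u / b 6 * q * g) * (b 6 * (f * b5 - t)) = - (u / b 6 * q * \<tau>) * b5 * (b 6 + t * f * (1 + (b 6)\<^sup>2) - t * v2)"
      unfolding 2 3 using nz b5_nz by (simp add: field_simps)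
    then have "\<tau> * ((r0 - u / b 6 * q * g) * (b 6 * (f * b5 - t))) = \<tau> * (- (u / b 6 * q) * b5 * (b 6 + t * f * (1 + (b 6)\<^sup>2) - t * v2))"
      by (simp only: mult_ac mult_minus_left mult_minus_right)
    then have "(r0 - u / b 6 * q * g) * (b 6 * (f * b5 - t)) = - (u / b 6 * q) * b5 * (b 6 + t * f * (1 + (b 6)\<^sup>2) - t * v2)"
      by (simp only: mult_left_cancel[OF \<tau>_nz])
    then have "r0 - u / b 6 * q * g = - (u / b 6 * q) * b5 * (b 6 + t * f * (1 + (b 6)\<^sup>2) - t * v2) / (b 6 * (f * b5 - t))"
      by (rule eq_divide_imp[OF d])
    moreover have "r0 = l * (q * g - q * b5 * x / y)" if "r0 - l * q * g = - (l * q) * b5 * x / y" for l x y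
      using that by (simp add: right_diff_distrib diff_eq_eq mult.assoc)
    ultimately have "r0 = u / b 6 * \<rho>" unfolding \<rho>_def by blast
    then show ?thesis unfolding \<open>\<rho> = r\<close> .
  qed
  show "poly Rp x = Y.\<gamma> (Suc k) / (b 6 * X.\<gamma> (Suc k)) * (x + r)"
    unfolding Rp r0 u_def by (simp add: distrib_left distrib_right add_divide_distrib mult_ac)
  have s0: "s0 = b 6 / v * (- r - q * t * (1 + (b 6)\<^sup>2) / b 6)"
  proof -
    \<comment> \<open>The determinant of B. The off-diagonal product is constant, so the coefficient
      of x is a linear equation for s0.\<close>
    have "Rp * Rm + Pp * Pm = smult (u / v) (Ep * Em)"
    proof (rule poly_eqI_at_infinity)
      show "\<forall>\<^sub>F x in at_infinity. poly (Rp * Rm + Pp * Pm) x = poly (smult (u / v) (Ep * Em)) x"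
        using evB
      proof eventually_elim
        case (elim x)
        have "\<alpha> * (Y.\<gamma> (Suc k) / Y.\<gamma> k) = u / v" unfolding \<alpha>_def u_def v_def by simp
        with XY.row_det[OF elim rowsB(1)[OF elim] rowsB(2)[OF elim], folded \<alpha>_def]
        show ?case by (simp only: poly_add poly_mult poly_minus poly_smult) simp
      qed
    qed
    have Rp_eq: "Rp = [:r0, u / b 6:]" and Rm_eq: "Rm = [:s0, b 6 / v:]"
      by (rule poly_eqI_at_infinity, simp add: Rp Rm mult.commute)+
    obtain z1 z2 where z: "Pp = [:z1:]" "Pm = [:z2:]" using Pp0(1) Pm0(1) by (metis degree_eq_zeroE)
    have "coeff (Rp * Rm + Pp * Pm) 1 = coeff (smult (u / v) (Ep * Em)) 1"
      using \<open>Rp * Rm + Pp * Pm = _\<close> by simp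
    then have *: "r0 * (b 6 / v) + u / b 6 * s0 = - (u / v * (q * t) * (b 6 + 1 / b 6))"
      unfolding Rp_eq Rm_eq z by (simp add: algebra_simps eq_neg_iff_add_eq_0)
    have ub: "u / b 6 \<noteq> 0" using uv nz by simp
    from * have "u / b 6 * (r * (b 6 / v) + s0) = u / b 6 * (b 6 / v * (- (q * t) * (b 6 + 1 / b 6)))"
      unfolding r0 using nz by (simp add: algebra_simps eq_neg_iff_add_eq_0)
    then have "r * (b 6 / v) + s0 = b 6 / v * (- (q * t) * (b 6 + 1 / b 6))"
      by (simp only: mult_left_cancel[OF ub])
    moreover have "q * t * (1 + (b 6)\<^sup>2) / b 6 = q * t * (b 6 + 1 / b 6)"
      using nz by (simp add: field_simps power2_eq_square)
    ultimately show ?thesis by algebra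
  qed
  show "poly Rm x = b 6 * X.\<gamma> k / Y.\<gamma> k * (x - r - q * t * (1 + (b 6)\<^sup>2) / b 6)"
    unfolding Rm s0 v_def by (simp add: algebra_simps)
qed

end

theorem proposition6:
  fixes q t b5 a\<^sub>n :: complex
    and b :: "nat \<Rightarrow> complex"
    and \<alpha> \<beta> :: "complex \<Rightarrow> complex"
    and p :: "nat \<Rightarrow> complex \<Rightarrow> complex poly"
    and \<gamma> :: "nat \<Rightarrow> complex \<Rightarrow> complex"
    and n :: nat
    and W\<^sub>p T\<^sub>p T\<^sub>m W\<^sub>m :: "complex \<Rightarrow> complex poly"
    and R\<^sub>p P\<^sub>p P\<^sub>m R\<^sub>m :: "complex poly"
    and g f :: "complex \<Rightarrow> complex"
  assumes q: "0 < norm q" "norm q < 1"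
    and b_nonzero: "b 1 \<noteq> 0" "b 2 \<noteq> 0" "b 3 \<noteq> 0" "b 4 \<noteq> 0" "b 6 \<noteq> 0"
    and b_prod: "b 1 * b 2 * b 3 * b 4 = 1"
    and t: "t \<noteq> 0"
    and terminals: "\<And>s. s \<in> {t, q * t} \<Longrightarrow> admissible_terminals q b (\<alpha> s) (\<beta> s) s"
    and spectral_eq: "\<And>s. s \<in> {t, q * t} \<Longrightarrow> stieltjes_spectral_eq q b (\<alpha> s) (\<beta> s) s"
    and deformation_eq: "stieltjes_deformation_eq q b (\<alpha> t) (\<beta> t) (\<alpha> (q * t)) (\<beta> (q * t)) t"
    and orthonormal:
      "\<And>s. s \<in> {t, q * t} \<Longrightarrow> orthonormal_system q b (\<alpha> s) (\<beta> s) s (\<lambda>m. p m s)"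
    and gamma: "\<And>m s. \<gamma> m s = lead_coeff (p m s)"
    and n: "n \<ge> 1"
    and a_n: "a\<^sub>n = \<gamma> (n - 1) t / \<gamma> n t"
    and b5: "b5 = b 1 * b 4 * b 6 * q ^ n"
    and A: "\<And>s. s \<in> {t, q * t} \<Longrightarrow>
      is_spectral_matrix q b (\<alpha> s) (\<beta> s) s (\<lambda>m. p m s) n
        (mat22 (W\<^sub>p s) (- T\<^sub>p s) (T\<^sub>m s) (W\<^sub>m s))"
    and B: "is_deformation_matrix q b (\<alpha> t) (\<beta> t) (\<alpha> (q * t)) (\<beta> (q * t)) t
        (\<lambda>m. p m t) (\<lambda>m. p m (q * t)) n (mat22 R\<^sub>p (- P\<^sub>p) P\<^sub>m R\<^sub>m)"
    and g: "\<And>s. s \<in> {t, q * t} \<Longrightarrow> poly (T\<^sub>p s div [:0, 1:]) (g s) = 0"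
    and g_generic: "\<And>s. s \<in> {t, q * t} \<Longrightarrow> g s \<noteq> 0 \<and> g s \<noteq> b 6 * s \<and> g s \<noteq> s / b 6"
    and f: "\<And>s. s \<in> {t, q * t} \<Longrightarrow>
      poly (W\<^sub>p s) (g s) =
        - (1 / s) * (g s - b 6 * s) * (b 6 * g s - s) * (f (s / q) * g s - 1)"
    and b5_generic: "b5\<^sup>2 \<noteq> 1 / q" "b5\<^sup>2 \<noteq> 1" "b5\<^sup>2 \<noteq> q"
    and denominators: "f t * g t - 1 \<noteq> 0" "t * g t - b5 \<noteq> 0" "f t * b5 - t \<noteq> 0"
  shows "(\<forall>x. poly R\<^sub>p x = \<gamma> n (q * t) / (b 6 * \<gamma> n t) *
            (x + 1 / (1 - b5\<^sup>2) *
              (- (q * (t\<^sup>2 * b 6 + (g t)\<^sup>2 * b5\<^sup>2 * b 6 - t * g t * b5\<^sup>2 * (1 + (b 6)\<^sup>2)) / (g t * b 6))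
               + q * t\<^sup>2 * b5 * (\<Prod>j=1..4. 1 - b j * g t)
                   / (g t * (f t * g t - 1) * (t * g t - b5))
               - q * (\<Prod>j=1..4. t - b j * b5) / ((t * g t - b5) * (f t * b5 - t)))))
       \<and> (\<forall>x. poly R\<^sub>m x = b 6 * \<gamma> (n - 1) t / \<gamma> (n - 1) (q * t) *
            (x + 1 / (1 - b5\<^sup>2) *
              (q * (t\<^sup>2 * b 6 + (g t)\<^sup>2 * b5\<^sup>2 * b 6 - t * g t * (1 + (b 6)\<^sup>2)) / (g t * b 6)
               - q * t\<^sup>2 * b5 * (\<Prod>j=1..4. 1 - b j * g t)
                   / (g t * (f t * g t - 1) * (t * g t - b5))
               + q * (\<Prod>j=1..4. t - b j * b5) / ((t * g t - b5) * (f t * b5 - t)))))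
       \<and> (\<forall>x. poly P\<^sub>p x =
            a\<^sub>n * (\<gamma> n (q * t) / (b 6 * \<gamma> n t) - b 6 * \<gamma> n t / \<gamma> n (q * t)))
       \<and> (\<forall>x. poly P\<^sub>m x =
            a\<^sub>n * (\<gamma> (n - 1) (q * t) / (b 6 * \<gamma> (n - 1) t)
                   - b 6 * \<gamma> (n - 1) t / \<gamma> (n - 1) (q * t)))"
proof -
  obtain k where k: "n = Suc k" using n by (cases n) auto
  have q_nz: "q \<noteq> 0" using q by auto
  interpret D: deformed_weight_system q b "\<alpha> t" "\<beta> t" t "\<lambda>m. p m t" k
      "\<alpha> (q * t)" "\<beta> (q * t)" "\<lambda>m. p m (q * t)"
    by unfold_locales
      (use q q_nz b_nonzero t terminals spectral_eq orthonormal deformation_eq in auto)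
  let ?g = "g t" and ?s = "q * t"
  define Y Z where "Y = q * t\<^sup>2 * b5 * (\<Prod>j=1..4. 1 - b j * ?g) / (?g * (f t * ?g - 1) * (t * ?g - b5))"
    and "Z = q * (\<Prod>j=1..4. t - b j * b5) / ((t * ?g - b5) * (f t * b5 - t))"
  define r where "r = 1 / (1 - b5\<^sup>2) *
      (- (q * (t\<^sup>2 * b 6 + ?g\<^sup>2 * b5\<^sup>2 * b 6 - t * ?g * b5\<^sup>2 * (1 + (b 6)\<^sup>2)) / (?g * b 6)) + Y - Z)"
  \<comment> \<open>At s = q t the defining relation involves f(s / q) = f(t).\<close>
  have f': "poly (W\<^sub>p ?s) (g ?s) =
      - (1 / ?s) * (g ?s - b 6 * ?s) * (b 6 * g ?s - ?s) * (f t * g ?s - 1)"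
    using f[of ?s] q_nz by simp
  note entries = D.deformation_matrix_entries[OF b_prod b5[unfolded k]
      A[of t, unfolded k, simplified] A[of ?s, unfolded k, simplified] B[unfolded k]
      g[of t, simplified] _ _ _ g[of ?s, simplified] _ _ _ f' b5_generic(1,2) denominators
      r_def[unfolded Y_def Z_def]]
  have ent: "poly R\<^sub>p x = \<gamma> n ?s / (b 6 * \<gamma> n t) * (x + r)"
    "poly R\<^sub>m x = b 6 * \<gamma> (n - 1) t / \<gamma> (n - 1) ?s * (x - r - q * t * (1 + (b 6)\<^sup>2) / b 6)"
    "poly P\<^sub>p x = a\<^sub>n * (\<gamma> n ?s / (b 6 * \<gamma> n t) - b 6 * \<gamma> n t / \<gamma> n ?s)"
    "poly P\<^sub>m x = a\<^sub>n * (\<gamma> (n - 1) ?s / (b 6 * \<gamma> (n - 1) t) - b 6 * \<gamma> (n - 1) t / \<gamma> (n - 1) ?s)" for x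
    unfolding a_n gamma k diff_Suc_1
    by (rule entries; use g_generic[of t] g_generic[of ?s] in simp)+
  \<comment> \<open>The first numerators in the brackets of R_+ and R_- differ by q t g (1 + b6^2)
    (1 - b5^2). Divided by g b6 (1 - b5^2) this is the extra term from the determinant of B.\<close>
  have "- r - q * t * (1 + (b 6)\<^sup>2) / b 6 = 1 / (1 - b5\<^sup>2) *
      (q * (t\<^sup>2 * b 6 + ?g\<^sup>2 * b5\<^sup>2 * b 6 - t * ?g * (1 + (b 6)\<^sup>2)) / (?g * b 6) - Y + Z)"
  proof -
    have nz: "?g \<noteq> 0" "b 6 \<noteq> 0" "1 - b5\<^sup>2 \<noteq> 0" using g_generic[of t] b_nonzero b5_generic by auto
    define d where "d = 1 - b5\<^sup>2"
    define w where "w = q * (t\<^sup>2 * b 6 + ?g\<^sup>2 * b5\<^sup>2 * b 6 - t * ?g * b5\<^sup>2 * (1 + (b 6)\<^sup>2)) / (?g * b 6)"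
    have "q * (t\<^sup>2 * b 6 + ?g\<^sup>2 * b5\<^sup>2 * b 6 - t * ?g * (1 + (b 6)\<^sup>2)) / (?g * b 6)
        = w - d * (q * t * (1 + (b 6)\<^sup>2) / b 6)"
      unfolding w_def d_def using nz by (simp add: divide_simps) (simp add: algebra_simps)
    moreover have "- (1 / d * (- w + Y - Z)) - z = 1 / d * (w - d * z - Y + Z)" for z
      using nz by (simp add: d_def divide_simps)
    ultimately show ?thesis unfolding r_def w_def[symmetric] d_def[symmetric] by simp
  qed
  then have "poly R\<^sub>m x = b 6 * \<gamma> (n - 1) t / \<gamma> (n - 1) ?s * (x + 1 / (1 - b5\<^sup>2) *
      (q * (t\<^sup>2 * b 6 + ?g\<^sup>2 * b5\<^sup>2 * b 6 - t * ?g * (1 + (b 6)\<^sup>2)) / (?g * b 6) - Y + Z))" for x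
    unfolding ent(2) by (simp only: diff_conv_add_uminus add.assoc)
  then show ?thesis
    using ent(1,3,4) unfolding r_def Y_def Z_def by blast
qed

end
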